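(* There exists a universal semi-POVM $M$ such that $[M(s),M(t)]=M(s)M(t)-M(t)M(s)\neq 0$ for all distinct $s,t\in\Sigma^*$ (here $N\ge 2$ so that non-commuting Hermitian matrices exist).
   Context: $N$ is a fixed positive integer; $\Sigma^*$ is the set of finite binary strings. $\mathrm{Her}(N)$ is the set of $N\times N$ Hermitian matrices and $\mathrm{Her}_Q(N)$ those with entries in $\{a+ib:a,b\in\mathbb{Q}\}$; $A\leqslant B$ means $B-A$ is positive semi-definite. A semi-POVM on $\Sigma^*$ is a map $R:\Sigma^*\to\mathrm{Her}(N)$ with $0\leqslant R(s)$ for all $s$ and $\sum_s R(s)\leqslant I$. A lower-computable semi-POVM is a semi-POVM $R$ for which there is a total recursive $f:\mathbb{N}\times\Sigma^*\to\mathrm{Her}_Q(N)$ with $\lim_{n}f(n,s)=R(s)$ and $f(n,s)\leqslant R(s)$ for all $n,s$. A universal semi-POVM is a lower-computable semi-POVM $M$ such that for every lower-computable semi-POVM $R$ there is $c>0$ with $c\,R(s)\leqslant M(s)$ for all $s\in\Sigma^*$. *)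

theory Defs
  imports "HOL-Analysis.Infinite_Sum" "HOL-Library.Nat_Bijection" "Jordan_Normal_Form.Matrix"
begin

datatype recf = Zero | Succ | Proj nat | Comp recf "recf list" | Prec recf recf | Mini recf

inductive rec_eval :: "recf \<Rightarrow> nat list \<Rightarrow> nat \<Rightarrow> bool" where
  zero: "rec_eval Zero xs 0"
| succ: "rec_eval Succ (x # xs) (Suc x)"
| proj: "i < length xs \<Longrightarrow> rec_eval (Proj i) xs (xs ! i)"
| comp: "list_all2 (\<lambda>g y. rec_eval g xs y) gs ys \<Longrightarrow> rec_eval f ys z \<Longrightarrow> rec_eval (Comp f gs) xs z"
| prec0: "rec_eval f xs z \<Longrightarrow> rec_eval (Prec f g) (0 # xs) z"
| precS: "rec_eval (Prec f g) (n # xs) y \<Longrightarrow> rec_eval g (n # y # xs) z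
          \<Longrightarrow> rec_eval (Prec f g) (Suc n # xs) z"
| mini: "rec_eval f (n # xs) 0 \<Longrightarrow> (\<forall>m<n. \<exists>y. 0 < y \<and> rec_eval f (m # xs) y)
          \<Longrightarrow> rec_eval (Mini f) xs n"

definition total_recursive :: "(nat \<Rightarrow> nat) \<Rightarrow> bool" where
  "total_recursive g \<longleftrightarrow> (\<exists>r. \<forall>x. rec_eval r [x] (g x))"

definition string_code :: "bool list \<Rightarrow> nat" where
  "string_code s = list_encode (map (\<lambda>b. if b then 1 else 0) s)"

definition rat_of_code :: "nat \<Rightarrow> rat" where
  "rat_of_code c = (case prod_decode c of (a, b) \<Rightarrow> of_int (int_decode a) / of_nat b)"

definition complex_of_code :: "nat \<Rightarrow> complex" where
  "complex_of_code c = (case prod_decode c of (a, b) \<Rightarrow>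
     complex_of_real (of_rat (rat_of_code a)) + \<i> * complex_of_real (of_rat (rat_of_code b)))"

definition hermitian :: "nat \<Rightarrow> complex mat \<Rightarrow> bool" where
  "hermitian N A \<longleftrightarrow> A \<in> carrier_mat N N \<and> (\<forall>i<N. \<forall>j<N. A $$ (i, j) = cnj (A $$ (j, i)))"

definition psd :: "nat \<Rightarrow> complex mat \<Rightarrow> bool" where
  "psd N A \<longleftrightarrow> hermitian N A \<and>
     (\<forall>v \<in> carrier_vec N. let q = (\<Sum>i<N. cnj (v $ i) * (A *\<^sub>v v) $ i) in Im q = 0 \<and> 0 \<le> Re q)"

definition loewner_le :: "nat \<Rightarrow> complex mat \<Rightarrow> complex mat \<Rightarrow> bool" where
  "loewner_le N A B \<longleftrightarrow> A \<in> carrier_mat N N \<and> B \<in> carrier_mat N N \<and> psd N (B - A)"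

definition semi_POVM :: "nat \<Rightarrow> (bool list \<Rightarrow> complex mat) \<Rightarrow> bool" where
  "semi_POVM N R \<longleftrightarrow>
     (\<forall>s. loewner_le N (0\<^sub>m N N) (R s)) \<and>
     (\<forall>i<N. \<forall>j<N. (\<lambda>s. R s $$ (i, j)) summable_on UNIV) \<and>
     loewner_le N (mat N N (\<lambda>(i, j). infsum (\<lambda>s. R s $$ (i, j)) UNIV)) (1\<^sub>m N)"

text \<open>Rational Hermitian approximations given by a total recursive f: N x Sigma* -> Her_Q(N);
  f is represented through a total recursive g producing codes of the entries.\<close>
definition lower_computable :: "nat \<Rightarrow> (bool list \<Rightarrow> complex mat) \<Rightarrow> bool" where
  "lower_computable N R \<longleftrightarrow> semi_POVM N R \<and>
     (\<exists>f :: nat \<Rightarrow> bool list \<Rightarrow> complex mat. \<exists>g.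
        total_recursive g \<and>
        (\<forall>n s. hermitian N (f n s) \<and>
           (\<forall>i<N. \<forall>j<N. f n s $$ (i, j) =
              complex_of_code (g (prod_encode (n, prod_encode (string_code s, prod_encode (i, j))))))) \<and>
        (\<forall>s. \<forall>i<N. \<forall>j<N. (\<lambda>n. f n s $$ (i, j)) \<longlonglongrightarrow> R s $$ (i, j)) \<and>
        (\<forall>n s. loewner_le N (f n s) (R s)))"

definition universal_semi_POVM :: "nat \<Rightarrow> (bool list \<Rightarrow> complex mat) \<Rightarrow> bool" where
  "universal_semi_POVM N M \<longleftrightarrow> lower_computable N M \<and>
     (\<forall>R. lower_computable N R \<longrightarrow>
        (\<exists>c::real. c > 0 \<and> (\<forall>s. loewner_le N (complex_of_real c \<cdot>\<^sub>m R s) (M s))))"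

end

theory Submission
  imports Defs "HOL-Analysis.Convex"
begin

text \<open>A positive semidefinite matrix satisfies \<open>R \<le> N * tr R * I\<close>, and the diagonal entries of a
  lower-computable semi-POVM are lower-semicomputable semimeasures. So if \<open>m\<close> is a universal
  lower-semicomputable semimeasure on strings, then \<open>m(s) * I\<close> already dominates every
  lower-computable semi-POVM up to a constant, and it remains to destroy commutativity by adding to
  \<open>m(s) / 2 * I\<close> a small computable multiple of the rank-one matrix \<open>v v\<^sup>T\<close> with
  \<open>v = (1, x, 0, \<dots>, 0)\<close>, where \<open>x\<close> is the code of \<open>s\<close>: for codes \<open>x\<close>, \<open>y\<close> the commutator has
  the entry \<open>(y - x) * (1 + x * y)\<close> up to a positive factor. The semimeasure \<open>m\<close> is obtained by
  letting every program request weights for strings, granting to the program with index \<open>e\<close> requests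
  of total weight at most \<open>1\<close>, and scaling the granted weights by \<open>2 ^ - Suc e\<close>.\<close>

section \<open>Closure properties of total recursive functions\<close>

text \<open>Nor can the total programs be listed effectively, so every number is run as a program
  with a step counter, and a program that diverges or asks for too much is merely cut off. Requests
  are unit fractions, so a running total is a pair of natural numbers and its comparison with 1 is
  exact. A program that never asks for more than 1 is never refused and loses only its scaling
  factor. The tilt is an exactly computable function of the code, so adding it preserves
  approximation from below. The part carrying \<open>m\<close> is scalar and drops out of every
  commutator, whose value therefore does not depend on the unknown numbers \<open>m(s)\<close>.
  Distinct nonnegative codes \<open>x\<close>, \<open>y\<close> make \<open>(1, x)\<close> and
  \<open>(1, y)\<close> neither parallel nor orthogonal, exactly the condition for their rank-one
  projections not to commute.\<close>

definition total_recursive2 :: "(nat \<Rightarrow> nat \<Rightarrow> nat) \<Rightarrow> bool" where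
  "total_recursive2 f \<longleftrightarrow> (\<exists>r. \<forall>x y. rec_eval r [x, y] (f x y))"

definition total_recursive3 :: "(nat \<Rightarrow> nat \<Rightarrow> nat \<Rightarrow> nat) \<Rightarrow> bool" where
  "total_recursive3 f \<longleftrightarrow> (\<exists>r. \<forall>x y z. rec_eval r [x, y, z] (f x y z))"

lemma rec_eval_Comp1:
  "rec_eval g xs y \<Longrightarrow> rec_eval f [y] z \<Longrightarrow> rec_eval (Comp f [g]) xs z"
  by (rule rec_eval.comp[where ys = "[y]"]) auto

lemma rec_eval_Comp2:
  "rec_eval g xs y \<Longrightarrow> rec_eval h xs y' \<Longrightarrow> rec_eval f [y, y'] z \<Longrightarrow> rec_eval (Comp f [g, h]) xs z"
  by (rule rec_eval.comp[where ys = "[y, y']"]) auto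

lemma total_recursive_id: "total_recursive (\<lambda>x. x)"
proof -
  have "rec_eval (Proj 0) [x] x" for x
    using rec_eval.proj[of 0 "[x]"] by simp
  then show ?thesis unfolding total_recursive_def by blast
qed

lemma total_recursive_comp:
  "total_recursive f \<Longrightarrow> total_recursive g \<Longrightarrow> total_recursive (\<lambda>x. f (g x))"
  unfolding total_recursive_def by (meson rec_eval_Comp1)

lemma total_recursive_Suc: "total_recursive f \<Longrightarrow> total_recursive (\<lambda>x. Suc (f x))"
  by (rule total_recursive_comp) (auto simp: total_recursive_def intro: rec_eval.succ)

lemma total_recursive_const: "total_recursive (\<lambda>x. c)"
proof (induction c)
  case 0
  then show ?case by (auto simp: total_recursive_def intro: rec_eval.zero)
next
  case (Suc c)
  then show ?case by (rule total_recursive_Suc)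
qed

lemma total_recursive2_proj:
  shows "total_recursive2 (\<lambda>x y. x)" and "total_recursive2 (\<lambda>x y. y)"
proof -
  have "rec_eval (Proj 0) [x, y] x" "rec_eval (Proj 1) [x, y] y" for x y
    using rec_eval.proj[of 0 "[x, y]"] rec_eval.proj[of 1 "[x, y]"] by simp_all
  then show "total_recursive2 (\<lambda>x y. x)" "total_recursive2 (\<lambda>x y. y)"
    unfolding total_recursive2_def by blast+
qed

lemma total_recursive3_proj:
  shows "total_recursive3 (\<lambda>x y z. x)" and "total_recursive3 (\<lambda>x y z. y)"
    and "total_recursive3 (\<lambda>x y z. z)"
proof -
  have "rec_eval (Proj 0) [x, y, z] x" "rec_eval (Proj 1) [x, y, z] y"
    "rec_eval (Proj 2) [x, y, z] z" for x y z
    using rec_eval.proj[of 0 "[x, y, z]"] rec_eval.proj[of 1 "[x, y, z]"]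
      rec_eval.proj[of 2 "[x, y, z]"] by simp_all
  then show "total_recursive3 (\<lambda>x y z. x)" "total_recursive3 (\<lambda>x y z. y)"
    "total_recursive3 (\<lambda>x y z. z)"
    unfolding total_recursive3_def by blast+
qed

lemma total_recursive2_comp1:
  "total_recursive f \<Longrightarrow> total_recursive2 g \<Longrightarrow> total_recursive2 (\<lambda>x y. f (g x y))"
  unfolding total_recursive_def total_recursive2_def by (meson rec_eval_Comp1)

lemma total_recursive3_comp1:
  "total_recursive f \<Longrightarrow> total_recursive3 g \<Longrightarrow> total_recursive3 (\<lambda>x y z. f (g x y z))"
  unfolding total_recursive_def total_recursive3_def by (meson rec_eval_Comp1)

lemma total_recursive_comp2:
  "total_recursive2 f \<Longrightarrow> total_recursive g \<Longrightarrow> total_recursive h \<Longrightarrow>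
    total_recursive (\<lambda>x. f (g x) (h x))"
  unfolding total_recursive_def total_recursive2_def by (meson rec_eval_Comp2)

lemma total_recursive2_comp2:
  "total_recursive2 f \<Longrightarrow> total_recursive2 g \<Longrightarrow> total_recursive2 h \<Longrightarrow>
    total_recursive2 (\<lambda>x y. f (g x y) (h x y))"
  unfolding total_recursive2_def by (meson rec_eval_Comp2)

lemma total_recursive3_comp2:
  "total_recursive2 f \<Longrightarrow> total_recursive3 g \<Longrightarrow> total_recursive3 h \<Longrightarrow>
    total_recursive3 (\<lambda>x y z. f (g x y z) (h x y z))"
  unfolding total_recursive2_def total_recursive3_def by (meson rec_eval_Comp2)

text \<open>The argument order of \<open>g\<close> (counter, previous value, parameter) is the one
  in which \<open>Prec\<close> calls its second term.\<close>

lemma total_recursive2_rec_nat: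
  assumes "total_recursive f" "total_recursive3 g"
  shows "total_recursive2 (\<lambda>n x. rec_nat (f x) (\<lambda>n y. g n y x) n)"
proof -
  obtain rf rg where "\<And>x. rec_eval rf [x] (f x)" "\<And>x y z. rec_eval rg [x, y, z] (g x y z)"
    using assms unfolding total_recursive_def total_recursive3_def by blast
  then have "rec_eval (Prec rf rg) [n, x] (rec_nat (f x) (\<lambda>n y. g n y x) n)" for n x
    by (induction n) (auto intro: rec_eval.prec0 rec_eval.precS)
  then show ?thesis unfolding total_recursive2_def by blast
qed

lemmas total_recursive23 =
  total_recursive2_proj total_recursive3_proj
  total_recursive2_comp1 total_recursive3_comp1 total_recursive2_comp2 total_recursive3_comp2

lemma total_recursive2_add: "total_recursive2 (+)"
proof -
  have "total_recursive2 (\<lambda>n x. rec_nat x (\<lambda>n y. Suc y) n)"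
    by (intro total_recursive2_rec_nat total_recursive_id
        total_recursive3_comp1[OF total_recursive_Suc] total_recursive23)
  moreover have "rec_nat x (\<lambda>n y. Suc y) n = n + x" for n x
    by (induction n) auto
  ultimately show ?thesis by simp
qed

lemma total_recursive2_diff: "total_recursive2 (-)"
proof -
  have pred: "total_recursive (\<lambda>n. rec_nat 0 (\<lambda>n y. n) n)"
    using total_recursive_comp2[OF total_recursive2_rec_nat[OF total_recursive_const
          total_recursive3_proj(1)] total_recursive_id total_recursive_id] .
  have "total_recursive2 (\<lambda>n x. rec_nat x (\<lambda>n y. rec_nat 0 (\<lambda>n y. n) y) n)"
    by (intro total_recursive2_rec_nat total_recursive_id
        total_recursive3_comp1[OF pred] total_recursive23)
  moreover have "rec_nat x (\<lambda>n y. rec_nat 0 (\<lambda>n y. n) y) n = x - n" for n x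
  proof (induction n)
    case (Suc n)
    then show ?case by (cases "x - n") auto
  qed simp
  ultimately have "total_recursive2 (\<lambda>n x. x - n)" by simp
  from total_recursive2_comp2[OF this total_recursive2_proj(2) total_recursive2_proj(1)]
  show ?thesis .
qed

lemma total_recursive2_mult: "total_recursive2 (*)"
proof -
  have "total_recursive2 (\<lambda>n x. rec_nat 0 (\<lambda>n y. x + y) n)"
    by (intro total_recursive2_rec_nat total_recursive_const
        total_recursive3_comp2[OF total_recursive2_add] total_recursive23)
  moreover have "rec_nat 0 (\<lambda>n y. x + y) n = n * x" for n x
    by (induction n) auto
  ultimately show ?thesis by simp
qed

lemmas total_recursive_add = total_recursive_comp2[OF total_recursive2_add]
lemmas total_recursive_diff = total_recursive_comp2[OF total_recursive2_diff]
lemmas total_recursive_mult = total_recursive_comp2[OF total_recursive2_mult]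

section \<open>The Cantor pairing function and its inverses\<close>

definition pfst :: "nat \<Rightarrow> nat" where "pfst z = fst (prod_decode z)"
definition psnd :: "nat \<Rightarrow> nat" where "psnd z = snd (prod_decode z)"
abbreviation pair :: "nat \<Rightarrow> nat \<Rightarrow> nat" where "pair a b \<equiv> prod_encode (a, b)"

lemma pfst_pair [simp]: "pfst (pair a b) = a"
  and psnd_pair [simp]: "psnd (pair a b) = b"
  and pair_collapse [simp]: "pair (pfst z) (psnd z) = z"
  by (simp_all add: pfst_def psnd_def)

lemma pfst_0: "pfst 0 = 0" and psnd_0: "psnd 0 = 0"
  using pfst_pair[of 0 0] psnd_pair[of 0 0] by (simp_all add: prod_encode_def)

lemma total_recursive_triangle: "total_recursive triangle"
proof -
  have "total_recursive2 (\<lambda>n x. rec_nat 0 (\<lambda>n y. y + Suc n) n)"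
    by (intro total_recursive2_rec_nat total_recursive_const
        total_recursive3_comp2[OF total_recursive2_add]
        total_recursive3_comp1[OF total_recursive_Suc[OF total_recursive_id]] total_recursive23)
  moreover have "rec_nat 0 (\<lambda>n y. y + Suc n) n = triangle n" for n
    by (induction n) auto
  ultimately have "total_recursive2 (\<lambda>n x. triangle n)" by simp
  from total_recursive_comp2[OF this total_recursive_id total_recursive_id]
  show ?thesis .
qed

lemma total_recursive2_pair: "total_recursive2 pair"
  unfolding prod_encode_def prod.case
  by (intro total_recursive2_comp2[OF total_recursive2_add]
      total_recursive2_comp1[OF total_recursive_triangle] total_recursive2_proj)

lemma mono_triangle: "m \<le> n \<Longrightarrow> triangle m \<le> triangle n"
  by (induction rule: dec_induct) auto

lemma le_triangle: "n \<le> triangle n"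
  by (induction n) auto

text \<open>The antidiagonal containing \<open>z = triangle d + a\<close>, \<open>a \<le> d\<close>, is found by counting the
  triangular numbers in \<open>{1..z}\<close>, so that no pair-valued recursion is needed.\<close>

lemma total_recursive_antidiagonal:
  "total_recursive (\<lambda>z. pfst z + psnd z)"
proof -
  have "total_recursive2 (\<lambda>n x. rec_nat 0 (\<lambda>n y. y + (1 - (triangle (Suc n) - x))) n)"
    by (intro total_recursive2_rec_nat total_recursive_const
        total_recursive3_comp2[OF total_recursive2_add]
        total_recursive3_comp2[OF total_recursive2_diff]
        total_recursive3_comp1[OF total_recursive_triangle]
        total_recursive3_comp1[OF total_recursive_Suc[OF total_recursive_id]]
        total_recursive3_comp1[OF total_recursive_const, of "\<lambda>x y z. x" 1] total_recursive3_proj)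
  from total_recursive_comp2[OF this total_recursive_id total_recursive_id]
  have tr: "total_recursive (\<lambda>z. rec_nat 0 (\<lambda>n y. y + (1 - (triangle (Suc n) - z))) z)" .
  have "rec_nat 0 (\<lambda>n y. y + (1 - (triangle (Suc n) - z))) z = pfst z + psnd z" for z
  proof -
    define a b where "a = pfst z" and "b = psnd z"
    have z: "z = triangle (a + b) + a"
      using pair_collapse[of z] by (simp add: prod_encode_def a_def b_def)
    \<comment> \<open>Truncated subtraction makes \<open>1 - (triangle (Suc n) - z)\<close> the
      indicator of \<open>triangle (Suc n) \<le> z\<close>, which holds exactly for
      \<open>Suc n \<le> a + b\<close>.\<close>
    have "rec_nat 0 (\<lambda>n y. y + (1 - (triangle (Suc n) - z))) k = min k (a + b)" for k
    proof (induction k)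
      case (Suc k)
      show ?case
      proof (cases "Suc k \<le> a + b")
        case True
        then have "triangle (Suc k) \<le> z"
          using mono_triangle[OF True] z by linarith
        then show ?thesis using Suc True by simp
      next
        case False
        then have "triangle (Suc (a + b)) \<le> triangle (Suc k)"
          by (intro mono_triangle) simp
        then have "triangle (Suc k) > z" using z by simp
        then show ?thesis using Suc False by simp
      qed
    qed simp
    moreover have "a + b \<le> z" using le_triangle[of "a + b"] z by linarith
    ultimately show ?thesis by (simp add: a_def b_def)
  qed
  with tr show ?thesis by simp
qed

lemma total_recursive_pfst: "total_recursive f \<Longrightarrow> total_recursive (\<lambda>x. pfst (f x))"
proof (rule total_recursive_comp[of pfst])
  have "pfst z = z - triangle (pfst z + psnd z)" for z
    using pair_collapse[of z] by (simp add: prod_encode_def)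
  moreover have "total_recursive (\<lambda>z. z - triangle (pfst z + psnd z))"
    by (intro total_recursive_diff total_recursive_id
        total_recursive_comp[OF total_recursive_triangle] total_recursive_antidiagonal)
  ultimately show "total_recursive pfst" by (metis (no_types, lifting) ext)
qed

lemma total_recursive_psnd: "total_recursive f \<Longrightarrow> total_recursive (\<lambda>x. psnd (f x))"
proof (rule total_recursive_comp[of psnd])
  have "psnd z = (pfst z + psnd z) - pfst z" for z
    by simp
  moreover have "total_recursive (\<lambda>z. (pfst z + psnd z) - pfst z)"
    by (intro total_recursive_diff total_recursive_id
        total_recursive_pfst total_recursive_antidiagonal)
  ultimately show "total_recursive psnd" by (metis (no_types, lifting) ext)
qed

lemmas total_recursive_pair = total_recursive_comp2[OF total_recursive2_pair]

text \<open>Packing the three arguments of \<open>g\<close> into one number keeps all later closure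
  rules about unary functions, so that they chain as introduction rules even through nested
  recursions.\<close>

lemma total_recursive_rec_nat:
  assumes "total_recursive a" "total_recursive k"
    and "total_recursive (\<lambda>p. g (pfst p) (pfst (psnd p)) (psnd (psnd p)))"
  shows "total_recursive (\<lambda>x. rec_nat (a x) (\<lambda>n y. g n y x) (k x))"
proof -
  have "total_recursive3 (\<lambda>n y x. (\<lambda>p. g (pfst p) (pfst (psnd p)) (psnd (psnd p))) (pair n (pair y x)))"
    by (intro total_recursive3_comp1[OF assms(3)]
        total_recursive3_comp2[OF total_recursive2_pair] total_recursive3_proj)
  then have "total_recursive3 g" by simp
  from total_recursive_comp2[OF total_recursive2_rec_nat[OF assms(1) this] assms(2) total_recursive_id]
  show ?thesis .
qed

section \<open>Case distinctions, powers and parity\<close>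

lemma total_recursive_if_zero:
  assumes "total_recursive a" "total_recursive f" "total_recursive g"
  shows "total_recursive (\<lambda>x. if a x = 0 then f x else g x)"
proof -
  have "total_recursive (\<lambda>x. (1 - a x) * f x + (1 - (1 - a x)) * g x)"
    by (intro total_recursive_add total_recursive_mult total_recursive_diff total_recursive_const assms)
  moreover have "(1 - a x) * f x + (1 - (1 - a x)) * g x = (if a x = 0 then f x else g x)" for x
    by auto
  ultimately show ?thesis by simp
qed

lemma total_recursive_if_le:
  assumes "total_recursive a" "total_recursive b" "total_recursive f" "total_recursive g"
  shows "total_recursive (\<lambda>x. if a x \<le> b x then f x else g x)"
  using total_recursive_if_zero[OF total_recursive_diff[OF assms(1,2)] assms(3,4)] by simp

lemma total_recursive_if_less:
  assumes "total_recursive a" "total_recursive b" "total_recursive f" "total_recursive g"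
  shows "total_recursive (\<lambda>x. if a x < b x then f x else g x)"
proof -
  have "(if b x \<le> a x then g x else f x) = (if a x < b x then f x else g x)" for x
    by auto
  with total_recursive_if_le[OF assms(2,1) assms(4,3)] show ?thesis by simp
qed

lemma total_recursive_if_eq:
  assumes "total_recursive a" "total_recursive b" "total_recursive f" "total_recursive g"
  shows "total_recursive (\<lambda>x. if a x = b x then f x else g x)"
proof -
  have "total_recursive (\<lambda>x. if (a x - b x) + (b x - a x) = 0 then f x else g x)"
    by (intro total_recursive_if_zero total_recursive_add total_recursive_diff assms)
  moreover have "(a x - b x) + (b x - a x) = 0 \<longleftrightarrow> a x = b x" for x by auto
  ultimately show ?thesis by simp
qed

text \<open>Decidable conditions are handled only through conditionals, so a conjunction is reduced
  to nested conditionals that the other rules can treat.\<close>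

lemma total_recursive_if_conj:
  assumes "total_recursive (\<lambda>x. if P x then if Q x then f x else g x else g x)"
  shows "total_recursive (\<lambda>x. if P x \<and> Q x then f x else g x)"
proof -
  have "(if P x then if Q x then f x else g x else g x) = (if P x \<and> Q x then f x else g x)" for x
    by simp
  with assms show ?thesis by simp
qed

lemma total_recursive_power:
  assumes "total_recursive f" "total_recursive g"
  shows "total_recursive (\<lambda>x. f x ^ g x)"
proof -
  have "total_recursive (\<lambda>x. rec_nat 1 (\<lambda>n y. f x * y) (g x))"
    by (intro total_recursive_rec_nat total_recursive_const total_recursive_mult assms
        total_recursive_comp[OF assms(1)] total_recursive_pfst total_recursive_psnd total_recursive_id)
  moreover have "rec_nat 1 (\<lambda>n y. a * y) n = a ^ n" for a n :: nat
    by (induction n) auto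
  ultimately show ?thesis by simp
qed

lemma total_recursive_mod2:
  assumes "total_recursive f"
  shows "total_recursive (\<lambda>x. f x mod 2)"
proof -
  have "total_recursive (\<lambda>x. rec_nat 0 (\<lambda>n y. 1 - y) (f x))"
    by (intro total_recursive_rec_nat total_recursive_const total_recursive_diff assms
        total_recursive_pfst total_recursive_psnd total_recursive_id)
  moreover have "rec_nat 0 (\<lambda>n y. 1 - y) n = n mod 2" for n :: nat
    by (induction n) (auto simp: mod_Suc)
  ultimately show ?thesis by simp
qed

lemmas total_recursive_intros =
  total_recursive_id total_recursive_const total_recursive_Suc total_recursive_add
  total_recursive_diff total_recursive_mult total_recursive_pfst total_recursive_psnd
  total_recursive_pair total_recursive_if_conj total_recursive_if_eq total_recursive_if_le
  total_recursive_if_less total_recursive_power total_recursive_mod2 total_recursive_rec_nat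

section \<open>A universal machine\<close>

text \<open>Together with 0 for the empty list this is the coding of \<open>list_encode\<close>, so
  a code is positive exactly when the list is nonempty.\<close>

definition ncons :: "nat \<Rightarrow> nat \<Rightarrow> nat" where "ncons a l = Suc (pair a l)"
definition nhd :: "nat \<Rightarrow> nat" where "nhd l = pfst (l - 1)"
definition ntl :: "nat \<Rightarrow> nat" where "ntl l = psnd (l - 1)"
definition nnth :: "nat \<Rightarrow> nat \<Rightarrow> nat" where "nnth l i = nhd (rec_nat l (\<lambda>_. ntl) i)"

lemma nhd_ncons [simp]: "nhd (ncons a l) = a"
  and ntl_ncons [simp]: "ntl (ncons a l) = l"
  and ncons_neq_0 [simp]: "ncons a l \<noteq> 0"
  by (simp_all add: nhd_def ntl_def ncons_def)

lemma list_encode_ncons: "list_encode (x # xs) = ncons x (list_encode xs)"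
  by (simp add: ncons_def)

lemma nnth_list_encode:
  assumes "i < length xs"
  shows "nnth (list_encode xs) i = xs ! i"
proof -
  have "i \<le> length xs \<Longrightarrow> rec_nat (list_encode xs) (\<lambda>_. ntl) i = list_encode (drop i xs)"
  proof (induction i)
    case (Suc i)
    then have "drop i xs = xs ! i # drop (Suc i) xs"
      by (simp add: Cons_nth_drop_Suc)
    then show ?case using Suc by (simp add: list_encode_ncons del: list_encode.simps)
  qed simp
  moreover have "drop i xs = xs ! i # drop (Suc i) xs"
    using assms by (simp add: Cons_nth_drop_Suc)
  ultimately show ?thesis
    using assms by (simp add: nnth_def list_encode_ncons del: list_encode.simps)
qed

lemma total_recursive_ncons:
  "total_recursive f \<Longrightarrow> total_recursive g \<Longrightarrow> total_recursive (\<lambda>x. ncons (f x) (g x))"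
  unfolding ncons_def by (intro total_recursive_intros)

lemma total_recursive_nhd: "total_recursive f \<Longrightarrow> total_recursive (\<lambda>x. nhd (f x))"
  unfolding nhd_def by (intro total_recursive_intros)

lemma total_recursive_ntl: "total_recursive f \<Longrightarrow> total_recursive (\<lambda>x. ntl (f x))"
  unfolding ntl_def by (intro total_recursive_intros)

lemma total_recursive_nnth:
  "total_recursive f \<Longrightarrow> total_recursive g \<Longrightarrow> total_recursive (\<lambda>x. nnth (f x) (g x))"
  unfolding nnth_def by (intro total_recursive_nhd total_recursive_ntl total_recursive_intros)

lemmas total_recursive_list_intros =
  total_recursive_ncons total_recursive_nhd total_recursive_ntl total_recursive_nnth

fun recf_code :: "recf \<Rightarrow> nat" where
  "recf_code Zero = pair 0 0"
| "recf_code Succ = pair 1 0"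
| "recf_code (Proj i) = pair 2 i"
| "recf_code (Comp f gs) = pair 3 (pair (recf_code f) (list_encode (map recf_code gs)))"
| "recf_code (Prec f g) = pair 4 (pair (recf_code f) (recf_code g))"
| "recf_code (Mini f) = pair 5 (recf_code f)"

text \<open>A stack machine evaluating coded \<open>recf\<close> terms. A state pairs a stack of tasks with a stack of
  values; a task \<open>pair (pair tag a) x\<close> with \<open>tag \<le> 5\<close> evaluates the term with code \<open>pair tag a\<close> on
  the argument list \<open>x\<close> and pushes its value. The other tags are continuations: 6 evaluates a list
  of terms and pushes the list of values, 7 conses the two topmost values, 8 applies a term to the
  list on top of the value stack, 9 and 10 continue primitive recursion and minimisation. A state
  with empty task stack is left for a dead state, so that a computation halts at one time only.\<close>

definition dead_state :: nat where
  "dead_state = pair (ncons (pair (pair 11 0) 0) 0) 0"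

definition exec :: "nat \<Rightarrow> nat \<Rightarrow> nat \<Rightarrow> nat \<Rightarrow> nat \<Rightarrow> nat" where
  "exec tag a x K V =
    (if tag = 0 then pair K (ncons 0 V)
     else if tag = 1 then pair K (ncons (Suc (nhd x)) V)
     else if tag = 2 then pair K (ncons (nnth x a) V)
     else if tag = 3 then
       pair (ncons (pair (pair 6 (psnd a)) x) (ncons (pair (pair 8 (pfst a)) 0) K)) V
     else if tag = 4 then
       (if nhd x = 0 then pair (ncons (pair (pfst a) (ntl x)) K) V
        else pair (ncons (pair (pair 4 a) (ncons (nhd x - 1) (ntl x)))
               (ncons (pair (pair 9 (psnd a)) (ncons (nhd x - 1) (ntl x))) K)) V)
     else if tag = 5 then
       pair (ncons (pair a (ncons 0 x)) (ncons (pair (pair 10 a) (ncons 0 x)) K)) V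
     else if tag = 6 then
       (if a = 0 then pair K (ncons 0 V)
        else pair (ncons (pair (nhd a) x)
               (ncons (pair (pair 6 (ntl a)) x) (ncons (pair (pair 7 0) 0) K))) V)
     else if tag = 7 then pair K (ncons (ncons (nhd (ntl V)) (nhd V)) (ntl (ntl V)))
     else if tag = 8 then pair (ncons (pair a (nhd V)) K) (ntl V)
     else if tag = 9 then
       pair (ncons (pair a (ncons (nhd x) (ncons (nhd V) (ntl x)))) K) (ntl V)
     else if tag = 10 then
       (if nhd V = 0 then pair K (ncons (nhd x) (ntl V))
        else pair (ncons (pair a (ncons (Suc (nhd x)) (ntl x)))
               (ncons (pair (pair 10 a) (ncons (Suc (nhd x)) (ntl x))) K)) (ntl V))
     else dead_state)"

definition step :: "nat \<Rightarrow> nat" where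
  "step s = (if pfst s = 0 then dead_state
     else exec (pfst (pfst (nhd (pfst s)))) (psnd (pfst (nhd (pfst s)))) (psnd (nhd (pfst s)))
       (ntl (pfst s)) (psnd s))"

lemma total_recursive_exec:
  assumes "total_recursive f" "total_recursive g" "total_recursive h"
    and "total_recursive k" "total_recursive v"
  shows "total_recursive (\<lambda>s. exec (f s) (g s) (h s) (k s) (v s))"
  unfolding exec_def by (intro total_recursive_list_intros total_recursive_intros assms)

lemma total_recursive_step: "total_recursive f \<Longrightarrow> total_recursive (\<lambda>x. step (f x))"
  unfolding step_def
  by (intro total_recursive_exec total_recursive_list_intros total_recursive_intros)

lemma step_task [simp]:
  "step (pair (ncons (pair (pair tag a) x) K) V) = exec tag a x K V"
  by (simp add: step_def)

lemma step_dead_state: "step dead_state = dead_state"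
  unfolding dead_state_def by (simp add: exec_def dead_state_def)

definition reaches :: "nat \<Rightarrow> nat \<Rightarrow> bool" where
  "reaches s s' \<longleftrightarrow> (\<exists>t. (step ^^ t) s = s')"

lemma reaches_refl: "reaches s s"
  unfolding reaches_def by (rule exI[of _ 0]) simp

lemma reaches_trans [trans]: "reaches s s' \<Longrightarrow> reaches s' s'' \<Longrightarrow> reaches s s''"
  unfolding reaches_def by (metis comp_apply funpow_add)

lemma reaches_step: "reaches (step s) s' \<Longrightarrow> reaches s s'"
  unfolding reaches_def by (metis comp_apply funpow_Suc_right)

lemma reaches_task:
  "reaches (exec tag a x K V) s \<Longrightarrow> reaches (pair (ncons (pair (pair tag a) x) K) V) s"
  by (rule reaches_step) simp

text \<open>Since every number is a pair, an evaluation task can be unfolded without first writing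
  its code as \<open>pair tag a\<close>.\<close>

lemma reaches_evalI:
  assumes "\<And>K V. reaches (exec (pfst c) (psnd c) x K V) (pair K (ncons y V))"
  shows "reaches (pair (ncons (pair c x) K) V) (pair K (ncons y V))"
  using reaches_task[of "pfst c" "psnd c", OF assms] by simp

text \<open>The value of the head is pushed before the list of the remaining values, so task 7 finds
  the head second from the top. The hypothesis ranges over all stacks because each evaluation runs
  on top of pending work.\<close>

lemma reaches_eval_list:
  assumes "list_all2 (\<lambda>g y. \<forall>K V. reaches (pair (ncons (pair (recf_code g) x) K) V) (pair K (ncons y V))) gs ys"
  shows "reaches (pair (ncons (pair (pair 6 (list_encode (map recf_code gs))) x) K) V)
    (pair K (ncons (list_encode ys) V))"
  using assms
proof (induction arbitrary: K V rule: list_all2_induct)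
  case Nil
  show ?case by (rule reaches_task) (simp add: exec_def reaches_refl)
next
  case (Cons g gs y ys)
  let ?gs = "list_encode (map recf_code gs)" and ?K = "ncons (pair (pair 7 0) 0) K"
  have "reaches (pair (ncons (pair (recf_code g) x) (ncons (pair (pair 6 ?gs) x) ?K)) V)
     (pair (ncons (pair (pair 6 ?gs) x) ?K) (ncons y V))"
    using Cons by blast
  also have "reaches \<dots> (pair ?K (ncons (list_encode ys) (ncons y V)))"
    by (rule Cons.IH)
  also have "reaches \<dots> (pair K (ncons (list_encode (y # ys)) V))"
    by (rule reaches_task) (simp add: exec_def reaches_refl list_encode_ncons del: list_encode.simps)
  finally show ?case
    by (intro reaches_task) (simp add: exec_def list_encode_ncons del: list_encode.simps)
qed

text \<open>Induction descends from the zero at \<open>n\<close>: a positive value at candidate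
  \<open>i\<close> sends the machine to candidate \<open>Suc i\<close>, from which the result is
  already known.\<close>

lemma reaches_minimisation:
  assumes z: "\<And>K V. reaches (pair (ncons (pair c (ncons n x)) K) V) (pair K (ncons 0 V))"
    and pos: "\<And>m. m < n \<Longrightarrow> \<exists>y>0. \<forall>K V. reaches (pair (ncons (pair c (ncons m x)) K) V) (pair K (ncons y V))"
    and "i \<le> n"
  shows "reaches (pair (ncons (pair c (ncons i x)) (ncons (pair (pair 10 c) (ncons i x)) K)) V)
    (pair K (ncons n V))"
  using \<open>i \<le> n\<close>
proof (induction i rule: inc_induct)
  case base
  have "reaches (pair (ncons (pair c (ncons n x)) (ncons (pair (pair 10 c) (ncons n x)) K)) V)
    (pair (ncons (pair (pair 10 c) (ncons n x)) K) (ncons 0 V))"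
    by (rule z)
  also have "reaches \<dots> (pair K (ncons n V))"
    by (rule reaches_task) (simp add: exec_def reaches_refl)
  finally show ?case .
next
  case (step i)
  obtain y where y: "y > 0"
    "\<forall>K V. reaches (pair (ncons (pair c (ncons i x)) K) V) (pair K (ncons y V))"
    using pos \<open>i < n\<close> by blast
  have "reaches (pair (ncons (pair c (ncons i x)) (ncons (pair (pair 10 c) (ncons i x)) K)) V)
    (pair (ncons (pair (pair 10 c) (ncons i x)) K) (ncons y V))"
    using y by blast
  also have "reaches \<dots> (pair K (ncons n V))"
    using step.IH y(1) by (intro reaches_task) (simp add: exec_def)
  finally show ?case .
qed

text \<open>Leaving both stacks arbitrary makes the induction compositional: each subterm is
  evaluated on top of the continuation of its parent.\<close>

lemma rec_eval_reaches:
  assumes "rec_eval r xs y"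
  shows "reaches (pair (ncons (pair (recf_code r) (list_encode xs)) K) V) (pair K (ncons y V))"
  using assms
proof (induction arbitrary: K V rule: rec_eval.induct)
  case (zero xs)
  show ?case by (rule reaches_evalI) (simp add: exec_def reaches_refl)
next
  case (succ x xs)
  show ?case
    by (rule reaches_evalI)
      (simp add: exec_def reaches_refl list_encode_ncons del: list_encode.simps)
next
  case (proj i xs)
  then show ?case
    by (intro reaches_evalI) (simp add: exec_def reaches_refl nnth_list_encode)
next
  case (comp xs gs ys f z)
  let ?gs = "list_encode (map recf_code gs)" and ?xs = "list_encode xs"
  have "list_all2 (\<lambda>g y. \<forall>K V. reaches (pair (ncons (pair (recf_code g) ?xs) K) V) (pair K (ncons y V))) gs ys"
    using comp.IH(1) by (rule list_all2_mono) blast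
  note args = reaches_eval_list[OF this]
  show ?case
  proof (rule reaches_evalI)
    fix K V
    have "reaches (pair (ncons (pair (pair 6 ?gs) ?xs) (ncons (pair (pair 8 (recf_code f)) 0) K)) V)
      (pair (ncons (pair (pair 8 (recf_code f)) 0) K) (ncons (list_encode ys) V))"
      by (rule args)
    also have "reaches \<dots> (pair K (ncons z V))"
      using comp.IH(2) by (intro reaches_task) (simp add: exec_def)
    finally show "reaches (exec (pfst (recf_code (Comp f gs))) (psnd (recf_code (Comp f gs))) ?xs K V)
        (pair K (ncons z V))"
      by (simp add: exec_def)
  qed
next
  case (prec0 f xs z g)
  then show ?case
    by (intro reaches_evalI) (simp add: exec_def list_encode_ncons del: list_encode.simps)
next
  case (precS f g n xs y z)
  let ?c = "recf_code (Prec f g)" and ?xs = "list_encode xs"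
  show ?case
  proof (rule reaches_evalI)
    fix K V
    have "reaches (pair (ncons (pair ?c (ncons n ?xs)) (ncons (pair (pair 9 (recf_code g)) (ncons n ?xs)) K)) V)
      (pair (ncons (pair (pair 9 (recf_code g)) (ncons n ?xs)) K) (ncons y V))"
      using precS.IH(1) by (simp only: list_encode_ncons)
    also have "reaches \<dots> (pair K (ncons z V))"
      using precS.IH(2)
      by (intro reaches_task) (simp add: exec_def list_encode_ncons del: list_encode.simps)
    finally show "reaches (exec (pfst ?c) (psnd ?c) (list_encode (Suc n # xs)) K V) (pair K (ncons z V))"
      by (simp add: exec_def list_encode_ncons del: list_encode.simps)
  qed
next
  case (mini f n xs)
  let ?c = "recf_code f" and ?xs = "list_encode xs"
  have *: "\<exists>y>0. \<forall>K V. reaches (pair (ncons (pair ?c (ncons m ?xs)) K) V) (pair K (ncons y V))"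
    if "m < n" for m
    using mini.IH(2) that by (metis list_encode_ncons)
  have "reaches (pair (ncons (pair ?c (ncons 0 ?xs)) (ncons (pair (pair 10 ?c) (ncons 0 ?xs)) K)) V)
    (pair K (ncons n V))" for K V
    using mini.IH(1) * by (intro reaches_minimisation) (simp_all only: list_encode_ncons)
  then show ?case
    by (intro reaches_evalI) (simp add: exec_def)
qed

section \<open>Step-counted runs and their outcomes\<close>

definition run :: "nat \<Rightarrow> nat \<Rightarrow> nat \<Rightarrow> nat" where
  "run e n t = rec_nat (pair (ncons (pair e (ncons n 0)) 0) 0) (\<lambda>_. step) t"

lemma total_recursive_run:
  assumes "total_recursive f" "total_recursive g" "total_recursive h"
  shows "total_recursive (\<lambda>x. run (f x) (g x) (h x))"
  unfolding run_def
  by (intro total_recursive_step total_recursive_list_intros total_recursive_intros assms)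

lemma run_funpow: "run e n t = (step ^^ t) (pair (ncons (pair e (ncons n 0)) 0) 0)"
  by (induction t) (simp_all add: run_def)

text \<open>A halted state moves to \<open>dead_state\<close>, a fixed point with nonempty task
  stack. Hence a result is seen at a single time and a request is not counted repeatedly.\<close>

lemma run_halts_once:
  assumes "pfst (run e n t) = 0" "pfst (run e n t') = 0"
  shows "t = t'"
proof -
  have False if t: "pfst (run e n t) = 0" "pfst (run e n t') = 0" and less: "t < t'" for t t'
  proof -
    have "run e n (Suc t) = dead_state"
      using t(1) by (simp add: run_def step_def)
    moreover have "run e n (Suc t + k) = (step ^^ k) (run e n (Suc t))" for k
      by (induction k) (simp_all add: run_def)
    moreover have "(step ^^ k) dead_state = dead_state" for k
      by (induction k) (simp_all add: step_dead_state)
    ultimately have "run e n (Suc t + (t' - Suc t)) = dead_state" by metis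
    with less t(2) show False by (simp add: dead_state_def)
  qed
  with assms show ?thesis by (metis linorder_neqE_nat)
qed

text \<open>The outcome \<open>0\<close> also stands for not halting at time exactly \<open>psnd l\<close>; as \<open>0 = pair 0 0\<close>, it
  will be read as a request of weight \<open>1 / 0 = 0\<close>.\<close>

definition outcome :: "nat \<Rightarrow> nat \<Rightarrow> nat" where
  "outcome e l = (if pfst (run e (pfst l) (psnd l)) = 0 then nhd (psnd (run e (pfst l) (psnd l))) else 0)"

lemma total_recursive_outcome:
  assumes "total_recursive f" "total_recursive g"
  shows "total_recursive (\<lambda>x. outcome (f x) (g x))"
  unfolding outcome_def
  by (intro total_recursive_run total_recursive_list_intros total_recursive_intros assms)

text \<open>In the rounds \<open>pair n t\<close> the program \<open>e\<close> issues the nonzero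
  value \<open>q n\<close> exactly once and otherwise 0, so its requests are those of
  \<open>q\<close>, merely delayed and interspersed with zeros.\<close>

lemma outcome_universal:
  assumes "total_recursive q"
  obtains e where "\<And>n. \<exists>t. outcome e (pair n t) = q n"
    and "\<And>n t t'. outcome e (pair n t) \<noteq> 0 \<Longrightarrow> outcome e (pair n t') \<noteq> 0 \<Longrightarrow> t = t'"
    and "\<And>n t. outcome e (pair n t) \<noteq> 0 \<Longrightarrow> outcome e (pair n t) = q n"
proof -
  obtain r where r: "\<And>x. rec_eval r [x] (q x)"
    using assms unfolding total_recursive_def by blast
  have halt: "\<exists>t. run (recf_code r) n t = pair 0 (ncons (q n) 0)" for n
    using rec_eval_reaches[OF r[of n], of 0 0]
    unfolding reaches_def run_funpow by (simp add: list_encode_ncons del: list_encode.simps(2))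
  have once: "outcome (recf_code r) (pair n t) \<noteq> 0 \<Longrightarrow> pfst (run (recf_code r) n t) = 0" for n t
    by (auto simp: outcome_def split: if_splits)
  show thesis
  proof
    show "\<exists>t. outcome (recf_code r) (pair n t) = q n" for n
    proof -
      obtain t where "run (recf_code r) n t = pair 0 (ncons (q n) 0)"
        using halt by blast
      then have "outcome (recf_code r) (pair n t) = q n" by (simp add: outcome_def)
      then show ?thesis ..
    qed
    show "t = t'" if "outcome (recf_code r) (pair n t) \<noteq> 0" "outcome (recf_code r) (pair n t') \<noteq> 0" for n t t'
      using run_halts_once once that by blast
    show "outcome (recf_code r) (pair n t) = q n" if "outcome (recf_code r) (pair n t) \<noteq> 0" for n t
    proof -
      obtain t' where t': "run (recf_code r) n t' = pair 0 (ncons (q n) 0)"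
        using halt by blast
      then have "t = t'" using run_halts_once once[OF that] by simp
      with t' show ?thesis by (simp add: outcome_def)
    qed
  qed
qed

section \<open>A universal semimeasure\<close>

definition fraction :: "nat \<Rightarrow> real" where
  "fraction y = real (pfst y) / real (psnd y)"

definition add_unit_fraction :: "nat \<Rightarrow> nat \<Rightarrow> nat" where
  "add_unit_fraction y v = pair (pfst y * v + psnd y) (psnd y * v)"

lemma fraction_add_unit_fraction:
  "psnd y > 0 \<Longrightarrow> v > 0 \<Longrightarrow> fraction (add_unit_fraction y v) = fraction y + 1 / real v"
  by (simp add: fraction_def add_unit_fraction_def field_simps)

lemma psnd_add_unit_fraction [simp]: "psnd (add_unit_fraction y v) = psnd y * v"
  by (simp add: add_unit_fraction_def)

lemma total_recursive_add_unit_fraction: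
  "total_recursive f \<Longrightarrow> total_recursive g \<Longrightarrow> total_recursive (\<lambda>x. add_unit_fraction (f x) (g x))"
  unfolding add_unit_fraction_def by (intro total_recursive_intros)

text \<open>Read as a list of requests, program \<open>e\<close> asks in round \<open>l\<close> to give weight \<open>1 / v\<close> to \<open>x\<close> when
  \<open>outcome e l = pair x v\<close> (nothing if \<open>v = 0\<close>). The request is granted if the total weight granted
  to \<open>e\<close> stays at most \<open>1\<close>; \<open>grant e l\<close> is then \<open>v\<close>, and \<open>0\<close> otherwise.\<close>

definition budget :: "nat \<Rightarrow> nat \<Rightarrow> nat" where
  "budget e l = rec_nat (pair 0 1) (\<lambda>l y.
     if pfst y * psnd (outcome e l) + psnd y \<le> psnd y * psnd (outcome e l)
     then add_unit_fraction y (psnd (outcome e l)) else y) l"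

definition grant :: "nat \<Rightarrow> nat \<Rightarrow> nat" where
  "grant e l = (if pfst (budget e l) * psnd (outcome e l) + psnd (budget e l)
       \<le> psnd (budget e l) * psnd (outcome e l) then psnd (outcome e l) else 0)"

lemma budget_0: "budget e 0 = pair 0 1"
  by (simp add: budget_def)

lemma budget_Suc: "budget e (Suc l) = (if pfst (budget e l) * psnd (outcome e l) + psnd (budget e l)
       \<le> psnd (budget e l) * psnd (outcome e l)
     then add_unit_fraction (budget e l) (psnd (outcome e l)) else budget e l)"
  by (simp add: budget_def)

lemma psnd_budget_pos: "psnd (budget e l) > 0"
  by (induction l) (auto simp: budget_0 budget_Suc intro: Nat.gr0I)

text \<open>The test in \<open>grant\<close> is this inequality with the positive denominators
  cleared, which keeps it within natural-number arithmetic.\<close>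

lemma grant_iff:
  "grant e l = (if psnd (outcome e l) > 0 \<and> fraction (budget e l) + 1 / real (psnd (outcome e l)) \<le> 1
     then psnd (outcome e l) else 0)"
proof (cases "psnd (outcome e l) = 0")
  case False
  define p q v where "p = pfst (budget e l)" and "q = psnd (budget e l)" and "v = psnd (outcome e l)"
  have "q > 0" "v > 0" using psnd_budget_pos False by (simp_all add: q_def v_def)
  then have "fraction (budget e l) + 1 / real v \<le> 1 \<longleftrightarrow> real (p * v + q) \<le> real (q * v)"
    by (simp add: fraction_def p_def[symmetric] q_def[symmetric] field_simps)
  then have "fraction (budget e l) + 1 / real v \<le> 1 \<longleftrightarrow> p * v + q \<le> q * v"
    by (simp only: of_nat_le_iff)
  with False show ?thesis by (simp add: grant_def p_def q_def v_def)
qed (simp add: grant_def)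

text \<open>A refused request has \<open>grant\<close> equal to 0 and contributes
  \<open>1 / 0 = 0\<close>.\<close>

lemma fraction_budget: "fraction (budget e l) = (\<Sum>i<l. 1 / real (grant e i))"
proof (induction l)
  case 0
  show ?case by (simp add: budget_0 fraction_def)
next
  case (Suc l)
  \<comment> \<open>A granted request has \<open>v > 0\<close> because the denominator
    \<open>q\<close> of the running total is positive; hence \<open>add_unit_fraction\<close> really
    adds \<open>1 / v\<close>.\<close>
  have "v > 0" if "p * v + q \<le> q * v" "q > 0" for p q v :: nat
    using that by (cases v) auto
  with Suc psnd_budget_pos[of e l] show ?case
    by (simp add: budget_Suc grant_def fraction_add_unit_fraction)
qed

lemma sum_grant_le_1: "(\<Sum>i<l. 1 / real (grant e i)) \<le> 1"
proof (induction l)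
  case (Suc l)
  then show ?case
    using fraction_budget[of e l] by (auto simp: grant_iff)
qed simp

lemma total_recursive_budget:
  assumes "total_recursive f" "total_recursive g"
  shows "total_recursive (\<lambda>x. budget (f x) (g x))"
  unfolding budget_def
  by (intro total_recursive_outcome total_recursive_add_unit_fraction total_recursive_intros
      assms total_recursive_comp[OF assms(1)])

lemma total_recursive_grant:
  assumes "total_recursive f" "total_recursive g"
  shows "total_recursive (\<lambda>x. grant (f x) (g x))"
  unfolding grant_def
  by (intro total_recursive_outcome total_recursive_budget total_recursive_intros assms)

text \<open>The index \<open>j\<close> codes a program together with a round, so that the double sum
  becomes one series whose partial sums are computable fractions.\<close>

definition share :: "nat \<Rightarrow> nat \<Rightarrow> real" where
  "share j x = (if pfst (outcome (pfst j) (psnd j)) = x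
     then 1 / real (grant (pfst j) (psnd j) * 2 ^ Suc (pfst j)) else 0)"

definition universal_semimeasure :: "nat \<Rightarrow> real" where
  "universal_semimeasure x = (\<Sum>j. share j x)"

text \<open>Refused requests are skipped explicitly, since adding \<open>1 / 0\<close> by
  \<open>add_unit_fraction\<close> would turn the denominator into 0.\<close>

definition semimeasure_approx :: "nat \<Rightarrow> nat \<Rightarrow> nat" where
  "semimeasure_approx n x = rec_nat (pair 0 1) (\<lambda>j y.
     if grant (pfst j) (psnd j) = 0 then y
     else if pfst (outcome (pfst j) (psnd j)) = x
       then add_unit_fraction y (grant (pfst j) (psnd j) * 2 ^ Suc (pfst j)) else y) n"

lemma total_recursive_semimeasure_approx:
  assumes "total_recursive f" "total_recursive g"
  shows "total_recursive (\<lambda>x. semimeasure_approx (f x) (g x))"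
  unfolding semimeasure_approx_def
  by (intro total_recursive_outcome total_recursive_add_unit_fraction total_recursive_grant
      total_recursive_intros assms total_recursive_comp[OF assms(2)])

lemma psnd_semimeasure_approx_pos: "psnd (semimeasure_approx n x) > 0"
  by (induction n) (auto simp: semimeasure_approx_def)

lemma fraction_semimeasure_approx: "fraction (semimeasure_approx n x) = (\<Sum>j<n. share j x)"
proof (induction n)
  case 0
  show ?case by (simp add: semimeasure_approx_def fraction_def)
next
  case (Suc n)
  have "semimeasure_approx (Suc n) x = (if grant (pfst n) (psnd n) = 0 then semimeasure_approx n x
     else if pfst (outcome (pfst n) (psnd n)) = x
       then add_unit_fraction (semimeasure_approx n x) (grant (pfst n) (psnd n) * 2 ^ Suc (pfst n))
       else semimeasure_approx n x)"
    by (simp add: semimeasure_approx_def)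
  then show ?case
    using Suc psnd_semimeasure_approx_pos[of n x] by (simp add: share_def fraction_add_unit_fraction)
qed

lemma share_nonneg: "share j x \<ge> 0"
  by (simp add: share_def)

lemma sum_share_le:
  assumes "finite X"
  shows "(\<Sum>x\<in>X. share j x) \<le> 1 / real (grant (pfst j) (psnd j)) / 2 ^ Suc (pfst j)"
proof -
  have "(\<Sum>x\<in>X. share j x) = (if pfst (outcome (pfst j) (psnd j)) \<in> X
      then 1 / real (grant (pfst j) (psnd j) * 2 ^ Suc (pfst j)) else 0)"
    unfolding share_def using assms by (simp add: sum.delta')
  then show ?thesis by simp
qed

text \<open>The indices below \<open>n\<close> decode into the square of pairs below
  \<open>n\<close>; there each program has received at most 1, and the factors
  \<open>1 / 2 ^ Suc e\<close> add up to less than 1. The bound is uniform in \<open>n\<close> and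
  so survives the limit.\<close>

lemma sum_sum_share_le_1:
  assumes "finite X"
  shows "(\<Sum>x\<in>X. \<Sum>j<n. share j x) \<le> 1"
proof -
  let ?w = "\<lambda>e l. 1 / real (grant e l) / 2 ^ Suc e :: real"
  have "(\<Sum>x\<in>X. \<Sum>j<n. share j x) = (\<Sum>j<n. \<Sum>x\<in>X. share j x)"
    by (rule sum.swap)
  also have "\<dots> \<le> (\<Sum>j<n. case prod_decode j of (e, l) \<Rightarrow> ?w e l)"
    using sum_share_le[OF assms] by (intro sum_mono) (simp add: pfst_def psnd_def case_prod_beta)
  also have "\<dots> = (\<Sum>(e, l)\<in>prod_decode ` {..<n}. ?w e l)"
    by (subst sum.reindex) (simp_all add: inj_prod_decode)
  also have "\<dots> \<le> (\<Sum>(e, l)\<in>{..<n} \<times> {..<n}. ?w e l)"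
  proof (rule sum_mono2)
    show "prod_decode ` {..<n} \<subseteq> {..<n} \<times> {..<n}"
    proof (rule image_subsetI)
      fix j assume "j \<in> {..<n}"
      moreover have "pfst j \<le> j" "psnd j \<le> j"
        using le_prod_encode_1[of "pfst j" "psnd j"] le_prod_encode_2[of "psnd j" "pfst j"] by simp_all
      ultimately show "prod_decode j \<in> {..<n} \<times> {..<n}"
        by (simp add: mem_Times_iff pfst_def psnd_def)
    qed
  qed auto
  also have "\<dots> = (\<Sum>e<n. (\<Sum>l<n. 1 / real (grant e l)) / 2 ^ Suc e)"
    by (simp add: sum.cartesian_product[symmetric] sum_divide_distrib)
  also have "\<dots> \<le> (\<Sum>e<n. 1 / 2 ^ Suc e)"
    by (intro sum_mono divide_right_mono sum_grant_le_1) simp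
  also have "\<dots> = 1 - 1 / 2 ^ n"
    by (induction n) (simp_all add: field_simps)
  finally show ?thesis by (simp add: order_trans)
qed

lemma summable_share: "summable (\<lambda>j. share j x)"
proof (rule bounded_imp_summable)
  show "(\<Sum>j\<le>n. share j x) \<le> 1" for n
    using sum_sum_share_le_1[of "{x}" "Suc n"] by (simp add: lessThan_Suc_atMost)
qed (rule share_nonneg)

lemma share_le_universal_semimeasure: "share j x \<le> universal_semimeasure x"
  unfolding universal_semimeasure_def
  using sum_le_suminf[OF summable_share, of "{j}"] share_nonneg by simp

lemma universal_semimeasure_nonneg: "universal_semimeasure x \<ge> 0"
  using share_nonneg[of 0 x] share_le_universal_semimeasure[of 0 x] by linarith

lemma semimeasure_approx_tendsto:
  "(\<lambda>n. fraction (semimeasure_approx n x)) \<longlonglongrightarrow> universal_semimeasure x"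
  unfolding fraction_semimeasure_approx universal_semimeasure_def
  by (rule summable_LIMSEQ[OF summable_share])

lemma semimeasure_approx_le: "fraction (semimeasure_approx n x) \<le> universal_semimeasure x"
  unfolding fraction_semimeasure_approx universal_semimeasure_def
  by (rule sum_le_suminf[OF summable_share]) (auto simp: share_nonneg)

lemma sum_universal_semimeasure_le_1:
  assumes "finite X"
  shows "(\<Sum>x\<in>X. universal_semimeasure x) \<le> 1"
proof (rule LIMSEQ_le_const2)
  show "(\<lambda>n. \<Sum>x\<in>X. \<Sum>j<n. share j x) \<longlonglongrightarrow> (\<Sum>x\<in>X. universal_semimeasure x)"
    using semimeasure_approx_tendsto by (intro tendsto_sum) (simp add: fraction_semimeasure_approx)
qed (use sum_sum_share_le_1[OF assms] in blast)

text \<open>Requests of total at most 1 are all granted, so \<open>c\<close> can be the scaling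
  factor \<open>1 / 2 ^ Suc e\<close> of a program \<open>e\<close> computing
  \<open>q\<close>.\<close>

lemma universal_semimeasure_dominates:
  assumes "total_recursive q" and q: "\<And>n. (\<Sum>i<n. 1 / real (psnd (q i))) \<le> 1"
  shows "\<exists>c>0. \<forall>n. c / real (psnd (q n)) \<le> universal_semimeasure (pfst (q n))"
proof -
  obtain e where e1: "\<And>n. \<exists>t. outcome e (pair n t) = q n"
    and e2: "\<And>n t t'. outcome e (pair n t) \<noteq> 0 \<Longrightarrow> outcome e (pair n t') \<noteq> 0 \<Longrightarrow> t = t'"
    and e3: "\<And>n t. outcome e (pair n t) \<noteq> 0 \<Longrightarrow> outcome e (pair n t) = q n"
    using outcome_universal[OF assms(1)] by blast
  \<comment> \<open>Each \<open>n\<close> has at most one round \<open>pair n t\<close> with nonzero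
    outcome, so the rounds below \<open>L\<close> inject into the requests \<open>q n\<close> with
    \<open>n < L\<close>.\<close>
  have total: "(\<Sum>l<L. 1 / real (psnd (outcome e l))) \<le> 1" for L
  proof -
    let ?H = "{l. l < L \<and> outcome e l \<noteq> 0}"
    have "(\<Sum>l<L. 1 / real (psnd (outcome e l))) = (\<Sum>l\<in>?H. 1 / real (psnd (outcome e l)))"
      by (rule sum.mono_neutral_right) (auto simp: psnd_0)
    also have "\<dots> = (\<Sum>l\<in>?H. 1 / real (psnd (q (pfst l))))"
    proof (rule sum.cong[OF refl])
      fix l assume "l \<in> ?H"
      then have "outcome e l = q (pfst l)" using e3[of "pfst l" "psnd l"] by simp
      then show "1 / real (psnd (outcome e l)) = 1 / real (psnd (q (pfst l)))" by simp
    qed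
    also have "\<dots> = (\<Sum>n\<in>pfst ` ?H. 1 / real (psnd (q n)))"
    proof (subst sum.reindex)
      show "inj_on pfst ?H"
      proof (rule inj_onI)
        fix l l' assume l: "l \<in> ?H" "l' \<in> ?H" "pfst l = pfst l'"
        then have "psnd l = psnd l'"
          using e2[of "pfst l" "psnd l" "psnd l'"] pair_collapse[of l] pair_collapse[of l'] by simp
        with l(3) show "l = l'" by (metis pair_collapse)
      qed
    qed simp
    also have "\<dots> \<le> (\<Sum>n<L. 1 / real (psnd (q n)))"
    proof (rule sum_mono2)
      have "pfst l \<le> l" for l using le_prod_encode_1[of "pfst l" "psnd l"] by simp
      then show "pfst ` ?H \<subseteq> {..<L}" using le_less_trans by auto
    qed auto
    also have "\<dots> \<le> 1" by (rule q)
    finally show ?thesis .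
  qed
  \<comment> \<open>If everything so far was granted, the budget plus the current request is a
    partial sum bounded by \<open>total\<close>, so this request is granted too.\<close>
  have grant: "grant e l = psnd (outcome e l)" for l
  proof (induction l rule: less_induct)
    case (less l)
    have "fraction (budget e l) + 1 / real (psnd (outcome e l)) = (\<Sum>i<Suc l. 1 / real (psnd (outcome e i)))"
      using less by (simp add: fraction_budget)
    with total[of "Suc l"] show ?case by (simp add: grant_iff)
  qed
  have "1 / 2 ^ Suc e / real (psnd (q n)) \<le> universal_semimeasure (pfst (q n))" for n
  proof -
    obtain t where t: "outcome e (pair n t) = q n" using e1 by blast
    then have "share (pair e (pair n t)) (pfst (q n)) = 1 / 2 ^ Suc e / real (psnd (q n))"
      by (simp add: share_def grant)
    with share_le_universal_semimeasure show ?thesis by metis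
  qed
  then show ?thesis by (intro exI[of _ "1 / 2 ^ Suc e"]) simp
qed

section \<open>Domination of lower-semicomputable semimeasures\<close>

lemma inj_string_code: "inj string_code"
proof (rule injI)
  fix s t assume "string_code s = string_code t"
  then have "map (\<lambda>b. if b then 1 else 0) s = map (\<lambda>b. if b then 1 else (0::nat)) t"
    by (simp add: string_code_def list_encode_eq)
  then show "s = t" by (rule map_injective) (simp add: inj_def)
qed

lemma string_code_Nil: "string_code [] = 0"
  and string_code_Cons: "string_code (b # s) = ncons (if b then 1 else 0) (string_code s)"
  by (simp_all add: string_code_def ncons_def)

lemma zero_mem_range_string_code: "0 \<in> range string_code"
  using string_code_Nil by (metis rangeI)

lemma length_le_string_code: "length s \<le> string_code s"
proof (induction s)
  case (Cons b s)
  have "string_code s \<le> pair (if b then 1 else 0) (string_code s)"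
    by (rule le_prod_encode_2)
  with Cons show ?case unfolding string_code_Cons ncons_def by simp
qed simp

definition strip :: "nat \<Rightarrow> nat" where
  "strip y = (if nhd y \<le> 1 then ntl y else y)"

text \<open>The length of a string is at most its code, so \<open>x\<close> strips empty it; a list
  entry above 1 stops the descent at a positive number. The test matters because approximations are
  known to be bounded at codes of strings only.\<close>

definition is_string_code :: "nat \<Rightarrow> bool" where
  "is_string_code x \<longleftrightarrow> rec_nat x (\<lambda>_. strip) x = 0"

lemma strip_string_code: "strip (string_code s) = string_code (tl s)"
proof (cases s)
  case Nil
  have "nhd 0 = 0" "ntl 0 = 0"
    by (simp_all add: nhd_def ntl_def pfst_0 psnd_0)
  then show ?thesis by (simp add: Nil strip_def string_code_Nil)
qed (simp add: strip_def string_code_Cons)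

lemma strip_mem_range_string_code:
  assumes "strip y \<in> range string_code"
  shows "y \<in> range string_code"
proof (cases "y \<noteq> 0 \<and> nhd y \<le> 1")
  case True
  then obtain s where s: "ntl y = string_code s"
    using assms by (auto simp: strip_def)
  have "y = ncons (nhd y) (ntl y)"
    using True by (simp add: ncons_def nhd_def ntl_def)
  also have "\<dots> = string_code ((nhd y = 1) # s)"
    using True s by (auto simp: string_code_Cons le_Suc_eq)
  finally show ?thesis by (rule range_eqI)
next
  case False
  with assms show ?thesis
    using zero_mem_range_string_code by (cases "y = 0") (simp_all add: strip_def)
qed

lemma is_string_code_iff: "is_string_code x \<longleftrightarrow> x \<in> range string_code"
proof
  have "rec_nat x (\<lambda>_. strip) n \<in> range string_code \<Longrightarrow> x \<in> range string_code" for n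
    by (induction n) (simp_all add: strip_mem_range_string_code)
  then show "is_string_code x \<Longrightarrow> x \<in> range string_code"
    unfolding is_string_code_def using zero_mem_range_string_code by metis
next
  assume "x \<in> range string_code"
  then obtain s where s: "x = string_code s" by blast
  have "rec_nat x (\<lambda>_. strip) n = string_code (drop n s)" for n
    by (induction n) (simp_all add: s strip_string_code drop_Suc tl_drop)
  then show "is_string_code x"
    unfolding is_string_code_def using length_le_string_code[of s] by (simp add: s string_code_Nil)
qed

lemma total_recursive_if_string_code:
  assumes "total_recursive f" "total_recursive a" "total_recursive b"
  shows "total_recursive (\<lambda>x. if is_string_code (f x) then a x else b x)"
proof -
  have *: "total_recursive (\<lambda>x. strip (g x))" if "total_recursive g" for g
    unfolding strip_def by (intro total_recursive_list_intros total_recursive_intros that)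
  show ?thesis
    unfolding is_string_code_def by (intro * total_recursive_intros assms)
qed

text \<open>The condition \<open>Re (complex_of_code c) > 1 / 2 ^ k\<close>; codes of nonnegative numerators are even,
  and a denominator \<open>0\<close> codes the number \<open>0\<close>.\<close>

definition exceeds :: "nat \<Rightarrow> nat \<Rightarrow> bool" where
  "exceeds c k \<longleftrightarrow> 0 < psnd (pfst c) \<and> pfst (pfst c) mod 2 = 0 \<and>
     2 * psnd (pfst c) < 2 ^ k * pfst (pfst c)"

lemma Re_complex_of_code:
  "Re (complex_of_code c) = of_int (int_decode (pfst (pfst c))) / of_nat (psnd (pfst c))"
  by (simp add: complex_of_code_def rat_of_code_def case_prod_beta pfst_def psnd_def of_rat_divide)

lemma exceeds_iff: "exceeds c k \<longleftrightarrow> 1 / 2 ^ k < Re (complex_of_code c)"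
proof -
  define a b where "a = pfst (pfst c)" and "b = psnd (pfst c)"
  have re: "Re (complex_of_code c) = of_int (int_decode a) / of_nat b"
    by (simp add: Re_complex_of_code a_def b_def)
  have "0 < b \<and> a mod 2 = 0 \<and> 2 * b < 2 ^ k * a \<longleftrightarrow> 1 / 2 ^ k < of_int (int_decode a) / real b"
  proof (cases "b > 0 \<and> even a")
    case True
    \<comment> \<open>The even code \<open>2 * a'\<close> decodes to \<open>a'\<close>, whence the
      factor 2 on the denominator in \<open>exceeds\<close>.\<close>
    then obtain a' where a': "a = 2 * a'" by blast
    have "2 * b < 2 ^ k * a \<longleftrightarrow> real b < real (2 ^ k * a')"
      unfolding a' of_nat_less_iff by simp
    also have "\<dots> \<longleftrightarrow> 1 / 2 ^ k < of_int (int_decode a) / real b"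
      using True by (simp add: a' int_decode_def sum_decode_def field_simps)
    finally show ?thesis using True by (simp add: even_iff_mod_2_eq_zero[symmetric])
  next
    case False
    have "of_int (int_decode a) / real b \<le> 0"
      using False by (cases "b = 0") (auto simp: int_decode_def sum_decode_def intro!: divide_nonpos_nonneg)
    moreover have "(0::real) < 1 / 2 ^ k" by simp
    ultimately have "\<not> 1 / 2 ^ k < of_int (int_decode a) / real b" by linarith
    then show ?thesis using False by (auto simp: even_iff_mod_2_eq_zero[symmetric])
  qed
  then show ?thesis by (simp add: exceeds_def re a_def b_def)
qed

lemma total_recursive_if_exceeds:
  assumes "total_recursive f" "total_recursive g" "total_recursive a" "total_recursive b"
  shows "total_recursive (\<lambda>x. if exceeds (f x) (g x) then a x else b x)"
  unfolding exceeds_def by (intro total_recursive_intros assms)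

text \<open>The exponents that occur start at the least \<open>K\<close> with
  \<open>1 / 2 ^ K < r\<close>, and the geometric tail from \<open>K\<close> stays below
  \<open>2 / 2 ^ K\<close>.\<close>

lemma sum_dyadic_below_le:
  fixes r :: real
  assumes "r \<ge> 0"
  shows "(\<Sum>k | k < L \<and> 1 / 2 ^ k < r. 1 / 2 ^ k) \<le> 2 * r"
proof (cases "{k. k < L \<and> 1 / 2 ^ k < r} = {}")
  case True
  show ?thesis unfolding True using assms by simp
next
  case False
  define K where "K = (LEAST k. 1 / 2 ^ k < r)"
  obtain k where k: "k < L" "1 / 2 ^ k < r" using False by blast
  from k(2) have K: "1 / 2 ^ K < r" unfolding K_def by (rule LeastI)
  from k(2) have "K \<le> k" unfolding K_def by (rule Least_le)
  with k(1) have "K < L" by simp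
  have "(\<Sum>k | k < L \<and> 1 / 2 ^ k < r. 1 / 2 ^ k) \<le> (\<Sum>k\<in>{K..<L}. 1 / 2 ^ k :: real)"
    by (rule sum_mono2) (auto simp: K_def Least_le)
  also have "\<dots> = 2 / 2 ^ K - 2 / 2 ^ L"
    using less_imp_le[OF \<open>K < L\<close>] by (induction L rule: dec_induct) simp_all
  also have "\<dots> \<le> 2 / 2 ^ K" by simp
  also have "\<dots> \<le> 2 * r" using K by simp
  finally show ?thesis .
qed

text \<open>The weights \<open>2 ^ - k\<close> with \<open>2 ^ - k < r s\<close> add up to at most \<open>2 * r s\<close>, and the largest of
  them is at least \<open>r s / 2\<close>. Hence requesting half of each weight for \<open>s\<close> as soon as some
  approximation exceeds it never overdraws the budget.\<close>

lemma universal_semimeasure_dominates_lower_computable: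
  fixes r :: "bool list \<Rightarrow> real"
  assumes h: "total_recursive h"
    and nonneg: "\<And>s. r s \<ge> 0"
    and total: "\<And>F. finite F \<Longrightarrow> (\<Sum>s\<in>F. r s) \<le> 1"
    and le: "\<And>n s. Re (complex_of_code (h (pair n (string_code s)))) \<le> r s"
    and lim: "\<And>s. (\<lambda>n. Re (complex_of_code (h (pair n (string_code s))))) \<longlonglongrightarrow> r s"
  shows "\<exists>c>0. \<forall>s. c * r s \<le> universal_semimeasure (string_code s)"
proof -
  \<comment> \<open>The count is 0 iff no approximation before \<open>j\<close> exceeds
    \<open>1 / 2 ^ k\<close>; the weight is requested only at the first one that does, hence
    once.\<close>
  define seen where
    "seen j x k = rec_nat (0::nat) (\<lambda>i y. if exceeds (h (pair i x)) k then Suc y else y) j" for j x k :: nat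
  have seen_iff: "seen j x k = 0 \<longleftrightarrow> (\<forall>i<j. \<not> exceeds (h (pair i x)) k)" for j x k
    unfolding seen_def by (induction j) (auto simp: less_Suc_eq)
  \<comment> \<open>Here \<open>n\<close> codes an approximation index, a number \<open>x\<close>
    and an exponent \<open>k\<close>; the request is for weight \<open>1 / (2 * 2 ^ k)\<close>, and
    0 stands for no request.\<close>
  define q where "q n = (if is_string_code (pfst (psnd n)) \<and>
      exceeds (h (pair (pfst n) (pfst (psnd n)))) (psnd (psnd n)) \<and>
      seen (pfst n) (pfst (psnd n)) (psnd (psnd n)) = 0
    then pair (pfst (psnd n)) (2 * 2 ^ psnd (psnd n)) else 0)" for n
  have "total_recursive q"
    unfolding q_def seen_def
    by (intro total_recursive_if_conj total_recursive_if_string_code total_recursive_if_exceeds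
        total_recursive_intros total_recursive_comp[OF h])
  have "(\<Sum>n<L. 1 / real (psnd (q n))) \<le> 1" for L
  proof -
    let ?H = "{n. n < L \<and> q n \<noteq> 0}"
    have H: "is_string_code (pfst (psnd n))"
      "exceeds (h (pair (pfst n) (pfst (psnd n)))) (psnd (psnd n))"
      "\<And>i. i < pfst n \<Longrightarrow> \<not> exceeds (h (pair i (pfst (psnd n)))) (psnd (psnd n))"
      "psnd (q n) = 2 * 2 ^ psnd (psnd n)" if "n \<in> ?H" for n
      using that by (auto simp: q_def seen_iff split: if_splits)
    define S where "S = {s. string_code s < L}"
    have "finite S"
      using finite_vimageI[OF finite_lessThan[of L] inj_string_code] by (simp add: S_def vimage_def)
    let ?P = "Sigma S (\<lambda>s. {k. k < L \<and> 1 / 2 ^ k < r s})"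
    let ?\<phi> = "\<lambda>(s, k). pair (string_code s) k"
    have inj: "inj ?\<phi>" using inj_string_code by (auto simp: inj_def)
    have "(\<Sum>n<L. 1 / real (psnd (q n))) = (\<Sum>n\<in>?H. 1 / real (psnd (q n)))"
      by (rule sum.mono_neutral_right) (auto simp: psnd_0)
    also have "\<dots> = (\<Sum>n\<in>?H. 1 / (2 * 2 ^ psnd (psnd n)))"
      by (rule sum.cong) (simp_all add: H(4) del: mem_Collect_eq)
    also have "\<dots> = (\<Sum>p\<in>psnd ` ?H. 1 / (2 * 2 ^ psnd p))"
    proof (subst sum.reindex)
      show "inj_on psnd ?H"
      proof (rule inj_onI)
        fix n n' assume n: "n \<in> ?H" "n' \<in> ?H" "psnd n = psnd n'"
        \<comment> \<open>Both are the first index at which the same threshold is exceeded.\<close>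
        have "pfst n = pfst n'"
          using H(2,3)[OF n(1)] H(2,3)[OF n(2)] n(3) by (metis linorder_neqE_nat)
        with n(3) show "n = n'" by (metis pair_collapse)
      qed
    qed simp
    also have "\<dots> \<le> (\<Sum>p\<in>?\<phi> ` ?P. 1 / (2 * 2 ^ psnd p))"
    proof (rule sum_mono2)
      show "finite (?\<phi> ` ?P)" using \<open>finite S\<close> by auto
      show "psnd ` ?H \<subseteq> ?\<phi> ` ?P"
      proof (rule image_subsetI)
        fix n assume n: "n \<in> ?H"
        then obtain s where s: "pfst (psnd n) = string_code s"
          using H(1) is_string_code_iff by blast
        have "psnd n \<le> n" "pfst (psnd n) \<le> psnd n" "psnd (psnd n) \<le> psnd n"
          using le_prod_encode_1[of "pfst (psnd n)" "psnd (psnd n)"]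
            le_prod_encode_2[of "psnd (psnd n)" "pfst (psnd n)"]
            le_prod_encode_2[of "psnd n" "pfst n"] by simp_all
        then have "string_code s < L" "psnd (psnd n) < L" using n s by auto
        moreover have "1 / 2 ^ psnd (psnd n) < r s"
          using H(2)[OF n] le[of "pfst n" s] unfolding exceeds_iff s by linarith
        ultimately have "(s, psnd (psnd n)) \<in> ?P" by (simp add: S_def)
        moreover have "psnd n = ?\<phi> (s, psnd (psnd n))"
          using pair_collapse[of "psnd n"] unfolding s by simp
        ultimately show "psnd n \<in> ?\<phi> ` ?P" by blast
      qed
    qed simp
    also have "\<dots> = (\<Sum>(s, k)\<in>?P. 1 / (2 * 2 ^ k))"
      by (subst sum.reindex) (use inj in \<open>auto simp: case_prod_beta intro: inj_on_subset\<close>)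
    also have "\<dots> = (\<Sum>s\<in>S. (\<Sum>k | k < L \<and> 1 / 2 ^ k < r s. 1 / 2 ^ k) / 2)"
      using \<open>finite S\<close> by (simp add: sum.Sigma[symmetric] sum_divide_distrib mult.commute)
    also have "\<dots> \<le> (\<Sum>s\<in>S. r s)"
    proof (rule sum_mono)
      fix s
      show "(\<Sum>k | k < L \<and> 1 / 2 ^ k < r s. 1 / 2 ^ k) / 2 \<le> r s"
        using sum_dyadic_below_le[OF nonneg[of s], of L] by linarith
    qed
    also have "\<dots> \<le> 1" by (rule total[OF \<open>finite S\<close>])
    finally show ?thesis .
  qed
  from universal_semimeasure_dominates[OF \<open>total_recursive q\<close> this]
  obtain c where c: "c > 0" "\<And>n. c / real (psnd (q n)) \<le> universal_semimeasure (pfst (q n))"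
    by blast
  \<comment> \<open>For the least \<open>K\<close> with \<open>1 / 2 ^ K < r s\<close> one has
    \<open>r s \<le> 2 / 2 ^ K\<close>, so the single request of weight
    \<open>1 / (2 * 2 ^ K)\<close> is worth at least \<open>r s / 4\<close>.\<close>
  have "c / 4 * r s \<le> universal_semimeasure (string_code s)" for s
  proof (cases "r s = 0")
    case True
    then show ?thesis by (simp add: universal_semimeasure_nonneg)
  next
    case False
    then have pos: "r s > 0" using nonneg[of s] by simp
    define K where "K = (LEAST k. 1 / 2 ^ k < r s)"
    have "\<exists>k. 1 / 2 ^ k < r s"
      using real_arch_pow_inv[OF pos, of "1/2"] by (simp add: power_one_over)
    then have K: "1 / 2 ^ K < r s" unfolding K_def by (rule LeastI_ex)
    have rK: "r s \<le> 2 / 2 ^ K"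
    proof (cases K)
      \<comment> \<open>The exponent 0 has no predecessor; here the bound comes from
        \<open>r s \<le> 1\<close>.\<close>
      case 0
      then show ?thesis using total[of "{s}"] by simp
    next
      case (Suc k)
      then have "\<not> 1 / 2 ^ k < r s" unfolding K_def by (intro not_less_Least) simp
      then show ?thesis by (simp add: Suc)
    qed
    have "\<exists>j. exceeds (h (pair j (string_code s))) K"
      using order_tendstoD(1)[OF lim K] unfolding exceeds_iff
      by (meson eventually_sequentially order_refl)
    then obtain j where j: "exceeds (h (pair j (string_code s))) K"
      "\<And>i. i < j \<Longrightarrow> \<not> exceeds (h (pair i (string_code s))) K"
      using exists_least_iff[of "\<lambda>j. exceeds (h (pair j (string_code s))) K"] by blast
    then have "q (pair j (pair (string_code s) K)) = pair (string_code s) (2 * 2 ^ K)"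
      by (simp add: q_def seen_iff is_string_code_iff)
    then have "c / (2 * 2 ^ K) \<le> universal_semimeasure (string_code s)"
      using c(2)[of "pair j (pair (string_code s) K)"] by simp
    moreover have "c / 4 * r s \<le> c / 4 * (2 / 2 ^ K)"
      using rK c(1) by (intro mult_left_mono) simp_all
    ultimately show ?thesis by simp
  qed
  with c(1) show ?thesis by (intro exI[of _ "c / 4"]) simp
qed

section \<open>Quadratic forms and the Loewner order\<close>

text \<open>Vectors are plain functions, of which only the values below \<open>N\<close> matter;
  this avoids carrier conditions.\<close>

definition quadratic_form :: "nat \<Rightarrow> complex mat \<Rightarrow> (nat \<Rightarrow> complex) \<Rightarrow> complex" where
  "quadratic_form N A v = (\<Sum>i<N. \<Sum>j<N. cnj (v i) * A $$ (i, j) * v j)"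

definition norm_square :: "nat \<Rightarrow> (nat \<Rightarrow> complex) \<Rightarrow> real" where
  "norm_square N v = (\<Sum>i<N. (cmod (v i))\<^sup>2)"

lemma norm_square_nonneg: "norm_square N v \<ge> 0"
  by (simp add: norm_square_def sum_nonneg)

lemma quadratic_form_mult_mat_vec:
  assumes "A \<in> carrier_mat N N" "v \<in> carrier_vec N"
  shows "(\<Sum>i<N. cnj (v $ i) * (A *\<^sub>v v) $ i) = quadratic_form N A (\<lambda>i. v $ i)"
  unfolding quadratic_form_def using assms
  by (intro sum.cong) (auto simp: scalar_prod_def sum_distrib_left mult.assoc atLeast0LessThan intro!: sum.cong)

lemma quadratic_form_cong:
  "(\<And>i. i < N \<Longrightarrow> v i = w i) \<Longrightarrow> quadratic_form N A v = quadratic_form N A w"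
  by (simp add: quadratic_form_def)

lemma hermitian_carrier: "hermitian N A \<Longrightarrow> A \<in> carrier_mat N N"
  unfolding hermitian_def by blast

lemma hermitian_index:
  "hermitian N A \<Longrightarrow> i < N \<Longrightarrow> j < N \<Longrightarrow> A $$ (i, j) = cnj (A $$ (j, i))"
  unfolding hermitian_def by blast

lemma hermitian_quadratic_form_real:
  assumes "hermitian N A"
  shows "Im (quadratic_form N A v) = 0"
proof -
  have "cnj (quadratic_form N A v) = (\<Sum>i<N. \<Sum>j<N. cnj (v j) * A $$ (j, i) * v i)"
    unfolding quadratic_form_def cnj_sum
  proof (intro sum.cong refl)
    fix i j assume "i \<in> {..<N}" "j \<in> {..<N}"
    then have "A $$ (j, i) = cnj (A $$ (i, j))" using hermitian_index[OF assms] by blast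
    then show "cnj (cnj (v i) * A $$ (i, j) * v j) = cnj (v j) * A $$ (j, i) * v i"
      by (simp add: mult_ac)
  qed
  also have "\<dots> = quadratic_form N A v"
    unfolding quadratic_form_def by (rule sum.swap)
  finally show ?thesis by (simp add: complex_eq_iff)
qed

lemma psd_iff: "psd N A \<longleftrightarrow> hermitian N A \<and> (\<forall>v. 0 \<le> Re (quadratic_form N A v))"
proof (cases "hermitian N A")
  case True
  then have A: "A \<in> carrier_mat N N" by (rule hermitian_carrier)
  have "quadratic_form N A v = quadratic_form N A (\<lambda>i. vec N v $ i)" for v
    by (rule quadratic_form_cong) simp
  then have "(\<forall>v\<in>carrier_vec N. 0 \<le> Re (quadratic_form N A (\<lambda>i. v $ i)))
      \<longleftrightarrow> (\<forall>v. 0 \<le> Re (quadratic_form N A v))"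
    by (metis vec_carrier)
  then show ?thesis
    using True
    by (auto simp: psd_def Let_def quadratic_form_mult_mat_vec[OF A] hermitian_quadratic_form_real)
qed (simp add: psd_def)

lemma quadratic_form_minus:
  assumes "A \<in> carrier_mat N N" "B \<in> carrier_mat N N"
  shows "quadratic_form N (A - B) v = quadratic_form N A v - quadratic_form N B v"
  using assms by (simp add: quadratic_form_def algebra_simps flip: sum_subtractf)

lemma loewner_leI:
  assumes "hermitian N A" "hermitian N B"
    and "\<And>v. Re (quadratic_form N A v) \<le> Re (quadratic_form N B v)"
  shows "loewner_le N A B"
proof -
  have AB: "A \<in> carrier_mat N N" "B \<in> carrier_mat N N"
    using assms by (simp_all add: hermitian_carrier)
  have "hermitian N (B - A)"
    unfolding hermitian_def
  proof (intro conjI allI impI)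
    show "B - A \<in> carrier_mat N N" using AB by (intro minus_carrier_mat)
    fix i j assume "i < N" "j < N"
    then have "A $$ (i, j) = cnj (A $$ (j, i))" "B $$ (i, j) = cnj (B $$ (j, i))"
      using hermitian_index[OF assms(1)] hermitian_index[OF assms(2)] by blast+
    then show "(B - A) $$ (i, j) = cnj ((B - A) $$ (j, i))"
      using AB \<open>i < N\<close> \<open>j < N\<close> by simp
  qed
  then show ?thesis
    using assms(3) AB by (simp add: loewner_le_def psd_iff quadratic_form_minus)
qed

lemma loewner_leD:
  assumes "loewner_le N A B"
  shows "Re (quadratic_form N A v) \<le> Re (quadratic_form N B v)"
proof -
  have "A \<in> carrier_mat N N" "B \<in> carrier_mat N N" "0 \<le> Re (quadratic_form N (B - A) v)"
    using assms by (auto simp: loewner_le_def psd_iff)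
  then show ?thesis by (simp add: quadratic_form_minus)
qed

text \<open>The vector \<open>e_i + u e_j\<close> is written as a sum so that \<open>i = j\<close>
  is covered as well; \<open>u = 0\<close> then gives the diagonal entries.\<close>

lemma quadratic_form_two:
  assumes "i < N" "j < N"
  shows "quadratic_form N A (\<lambda>k. (if k = i then 1 else 0) + (if k = j then u else 0)) =
    A $$ (i, i) + A $$ (i, j) * u + cnj u * A $$ (j, i) + cnj u * A $$ (j, j) * u"
proof -
  let ?v = "\<lambda>k. (if k = i then 1 else 0) + (if k = j then u else 0)"
  have "(\<Sum>l<N. cnj (?v k) * A $$ (k, l) * ?v l) = cnj (?v k) * (A $$ (k, i) + A $$ (k, j) * u)" for k
  proof -
    have "(\<Sum>l<N. cnj (?v k) * A $$ (k, l) * ?v l) =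
        cnj (?v k) * (\<Sum>l<N. (if l = i then A $$ (k, l) else 0) + (if l = j then A $$ (k, l) * u else 0))"
      unfolding sum_distrib_left by (rule sum.cong) (auto simp: algebra_simps)
    then show ?thesis using assms by (simp add: sum.distrib)
  qed
  then have "quadratic_form N A ?v = (\<Sum>k<N. cnj (?v k) * (A $$ (k, i) + A $$ (k, j) * u))"
    by (simp add: quadratic_form_def)
  also have "\<dots> = (\<Sum>k<N. (if k = i then A $$ (k, i) + A $$ (k, j) * u else 0) +
      (if k = j then cnj u * (A $$ (k, i) + A $$ (k, j) * u) else 0))"
    by (rule sum.cong) (auto simp: algebra_simps)
  also have "\<dots> = A $$ (i, i) + A $$ (i, j) * u + cnj u * (A $$ (j, i) + A $$ (j, j) * u)"
    using assms by (simp add: sum.distrib)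
  finally show ?thesis by (simp add: algebra_simps)
qed

lemma quadratic_form_unit:
  assumes "i < N"
  shows "quadratic_form N A (\<lambda>k. if k = i then 1 else 0) = A $$ (i, i)"
  using quadratic_form_two[OF assms assms, of A 0] by (simp cong: if_cong)

lemma loewner_le_diag:
  assumes "loewner_le N A B" "i < N"
  shows "Re (A $$ (i, i)) \<le> Re (B $$ (i, i))"
  using loewner_leD[OF assms(1), of "\<lambda>k. if k = i then 1 else 0"] quadratic_form_unit[OF assms(2)] by simp

lemma psd_diag_nonneg:
  assumes "psd N A" "i < N"
  shows "0 \<le> Re (A $$ (i, i))"
  using assms quadratic_form_unit[OF assms(2), of A] by (metis psd_iff)

text \<open>On \<open>e_i + u e_j\<close>, with the phase \<open>u\<close> turning the entry
  \<open>(i, j)\<close> into minus its modulus, the form equals the two diagonal entries minus twice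
  that modulus, and it is nonnegative.\<close>

lemma psd_entry_le:
  assumes "psd N A" "i < N" "j < N"
  shows "cmod (A $$ (i, j)) \<le> (Re (A $$ (i, i)) + Re (A $$ (j, j))) / 2"
proof (cases "A $$ (i, j) = 0")
  case True
  then show ?thesis using psd_diag_nonneg assms by simp
next
  case False
  define u where "u = - cnj (sgn (A $$ (i, j)))"
  have Au: "A $$ (i, j) * u = - complex_of_real (cmod (A $$ (i, j)))"
    using False by (simp add: u_def sgn_eq complex_norm_square[symmetric] power2_eq_square)
  have "cmod u = 1" using False by (simp add: u_def norm_sgn)
  then have uu: "cnj u * u = 1" using complex_norm_square[of u] by (simp add: mult.commute)
  have "A $$ (j, i) = cnj (A $$ (i, j))"
    using assms psd_iff hermitian_index by blast
  then have "cnj u * A $$ (j, i) = cnj (A $$ (i, j) * u)" by (simp add: mult.commute)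
  then have uA: "cnj u * A $$ (j, i) = - complex_of_real (cmod (A $$ (i, j)))" by (simp add: Au)
  have uAu: "cnj u * A $$ (j, j) * u = A $$ (j, j)"
    using uu by (metis mult.assoc mult.commute mult_1)
  have "Re (quadratic_form N A (\<lambda>k. (if k = i then 1 else 0) + (if k = j then u else 0))) =
      Re (A $$ (i, i)) + Re (A $$ (j, j)) - 2 * cmod (A $$ (i, j))"
    unfolding quadratic_form_two[OF assms(2,3)] Au uA uAu by simp
  moreover have "0 \<le> Re (quadratic_form N A (\<lambda>k. (if k = i then 1 else 0) + (if k = j then u else 0)))"
    using assms(1) by (simp add: psd_iff)
  ultimately show ?thesis by simp
qed

text \<open>Every entry is bounded by the trace, and
  \<open>2 |v_i| |v_j| \<le> |v_i|^2 + |v_j|^2\<close>; summing over both indices produces the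
  factor \<open>N\<close>.\<close>

lemma psd_quadratic_form_le_trace:
  assumes "psd N A"
  shows "Re (quadratic_form N A v) \<le> real N * (\<Sum>i<N. Re (A $$ (i, i))) * norm_square N v"
proof -
  define T where "T = (\<Sum>i<N. Re (A $$ (i, i)))"
  have diag: "Re (A $$ (i, i)) \<le> T" if "i < N" for i
    unfolding T_def by (rule member_le_sum) (use that psd_diag_nonneg[OF assms] in auto)
  have "T \<ge> 0" unfolding T_def using psd_diag_nonneg[OF assms] by (intro sum_nonneg) simp
  have "Re (quadratic_form N A v) \<le> cmod (quadratic_form N A v)"
    by (rule complex_Re_le_cmod)
  also have "\<dots> \<le> (\<Sum>i<N. \<Sum>j<N. T * (((cmod (v i))\<^sup>2 + (cmod (v j))\<^sup>2) / 2))"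
    unfolding quadratic_form_def
  proof (intro order_trans[OF norm_sum] sum_mono)
    fix i j assume "i \<in> {..<N}" "j \<in> {..<N}"
    then have "cmod (A $$ (i, j)) \<le> T"
      using psd_entry_le[OF assms, of i j] diag[of i] diag[of j] by simp
    moreover have "cmod (v i) * cmod (v j) \<le> ((cmod (v i))\<^sup>2 + (cmod (v j))\<^sup>2) / 2"
      using sum_squares_bound[of "cmod (v i)" "cmod (v j)"] by simp
    ultimately have "cmod (A $$ (i, j)) * (cmod (v i) * cmod (v j)) \<le>
        T * (((cmod (v i))\<^sup>2 + (cmod (v j))\<^sup>2) / 2)"
      using \<open>T \<ge> 0\<close> by (intro mult_mono) auto
    then show "cmod (cnj (v i) * A $$ (i, j) * v j) \<le> T * (((cmod (v i))\<^sup>2 + (cmod (v j))\<^sup>2) / 2)"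
      by (simp add: norm_mult mult_ac)
  qed
  also have "\<dots> = T * (\<Sum>i<N. \<Sum>j<N. ((cmod (v i))\<^sup>2 + (cmod (v j))\<^sup>2) / 2)"
    by (simp only: sum_distrib_left)
  also have "(\<Sum>i<N. \<Sum>j<N. ((cmod (v i))\<^sup>2 + (cmod (v j))\<^sup>2) / 2) = real N * norm_square N v"
    by (simp add: norm_square_def sum.distrib sum_divide_distrib[symmetric] sum_distrib_left[symmetric])
  finally show ?thesis by (simp add: T_def mult_ac)
qed

section \<open>Tilted matrices and their commutators\<close>

definition tilt :: "nat \<Rightarrow> nat \<Rightarrow> nat" where
  "tilt x i = (if i < 2 then x ^ i else 0)"

text \<open>The factor \<open>1 + x ^ 2\<close> is the squared norm of the vector
  \<open>tilt x\<close>, \<open>2 ^ x\<close> makes the tilts summable over all codes, and 4 brings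
  their total down to at most 1/2.\<close>

definition tilt_scale :: "nat \<Rightarrow> nat" where
  "tilt_scale x = 4 * 2 ^ x * (1 + x ^ 2)"

text \<open>The weight \<open>a\<close> is a parameter because the rational approximations and their
  limit are all of this form.\<close>

definition tilted_mat :: "nat \<Rightarrow> real \<Rightarrow> nat \<Rightarrow> complex mat" where
  "tilted_mat N a x = mat N N (\<lambda>(i, j). complex_of_real
     ((if i = j then a / 2 else 0) + real (tilt x i) * real (tilt x j) / real (tilt_scale x)))"

lemma tilted_mat_carrier [simp]: "tilted_mat N a x \<in> carrier_mat N N"
  by (simp add: tilted_mat_def)

lemma tilted_mat_index:
  "i < N \<Longrightarrow> j < N \<Longrightarrow> tilted_mat N a x $$ (i, j) = complex_of_real
     ((if i = j then a / 2 else 0) + real (tilt x i) * real (tilt x j) / real (tilt_scale x))"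
  by (simp add: tilted_mat_def)

lemma hermitian_tilted_mat: "hermitian N (tilted_mat N a x)"
  unfolding hermitian_def by (simp add: tilted_mat_index mult.commute)

lemma tilt_scale_pos: "real (tilt_scale x) > 0"
  unfolding of_nat_0_less_iff by (simp add: tilt_scale_def)

lemma quadratic_form_tilted_mat:
  "Re (quadratic_form N (tilted_mat N a x) v) = a / 2 * norm_square N v +
     (cmod (\<Sum>i<N. of_real (real (tilt x i)) * v i))\<^sup>2 / real (tilt_scale x)"
proof -
  let ?u = "\<lambda>i. complex_of_real (real (tilt x i))"
  let ?q = "complex_of_real (real (tilt_scale x))"
  have "quadratic_form N (tilted_mat N a x) v =
      (\<Sum>i<N. \<Sum>j<N. (if i = j then of_real (a / 2) * (v i * cnj (v i)) else 0) +
        (?u j * v j) * cnj (?u i * v i) / ?q)"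
    unfolding quadratic_form_def
  proof (intro sum.cong refl)
    fix i j assume "i \<in> {..<N}" "j \<in> {..<N}"
    then show "cnj (v i) * tilted_mat N a x $$ (i, j) * v j =
        (if i = j then of_real (a / 2) * (v i * cnj (v i)) else 0) +
        (?u j * v j) * cnj (?u i * v i) / ?q"
      by (simp add: tilted_mat_index algebra_simps)
  qed
  also have "\<dots> = (\<Sum>i<N. of_real (a / 2) * (v i * cnj (v i))) +
      (\<Sum>i<N. \<Sum>j<N. (?u j * v j) * cnj (?u i * v i)) / ?q"
    by (simp add: sum.distrib sum_divide_distrib)
  also have "(\<Sum>i<N. of_real (a / 2) * (v i * cnj (v i))) = of_real (a / 2 * norm_square N v)"
    by (simp only: norm_square_def of_real_mult of_real_sum complex_norm_square sum_distrib_left)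
  also have "(\<Sum>i<N. \<Sum>j<N. (?u j * v j) * cnj (?u i * v i)) =
      (\<Sum>j<N. ?u j * v j) * cnj (\<Sum>i<N. ?u i * v i)"
    unfolding cnj_sum sum_product by (rule sum.swap)
  also have "\<dots> = of_real ((cmod (\<Sum>i<N. ?u i * v i))\<^sup>2)"
    by (simp only: complex_norm_square)
  finally show ?thesis by (simp flip: of_real_divide)
qed

lemma quadratic_form_tilted_mat_le:
  assumes "2 \<le> N"
  shows "Re (quadratic_form N (tilted_mat N a x) v) \<le> (a / 2 + 1 / (4 * 2 ^ x)) * norm_square N v"
proof -
  have "cmod (\<Sum>i<N. of_real (real (tilt x i)) * v i) \<le> (\<Sum>i<N. real (tilt x i) * cmod (v i))"
    by (rule order_trans[OF norm_sum]) (simp add: norm_mult)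
  then have "(cmod (\<Sum>i<N. of_real (real (tilt x i)) * v i))\<^sup>2 \<le> (\<Sum>i<N. real (tilt x i) * cmod (v i))\<^sup>2"
    by (intro power_mono) auto
  also have "\<dots> \<le> (\<Sum>i<N. (real (tilt x i))\<^sup>2) * norm_square N v"
    unfolding norm_square_def by (rule Cauchy_Schwarz_ineq_sum)
  also have "(\<Sum>i<N. (real (tilt x i))\<^sup>2) = (\<Sum>i<2. (real (tilt x i))\<^sup>2)"
    by (rule sum.mono_neutral_right) (use assms in \<open>auto simp: tilt_def\<close>)
  also have "\<dots> = 1 + real x ^ 2"
    by (simp add: tilt_def numeral_2_eq_2)
  finally have "(cmod (\<Sum>i<N. of_real (real (tilt x i)) * v i))\<^sup>2 / real (tilt_scale x) \<le>
      (1 + real x ^ 2) * norm_square N v / real (tilt_scale x)"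
    by (rule divide_right_mono) simp
  also have "\<dots> = 1 / (4 * 2 ^ x) * norm_square N v"
  proof -
    have "1 + real x ^ 2 \<noteq> 0" by (metis add_nonneg_eq_0_iff zero_le_one zero_le_power2 zero_neq_one)
    moreover have "real (tilt_scale x) = (4 * 2 ^ x) * (1 + real x ^ 2)"
      unfolding tilt_scale_def by (simp add: algebra_simps)
    ultimately show ?thesis by simp
  qed
  finally show ?thesis
    unfolding quadratic_form_tilted_mat by (simp add: algebra_simps)
qed

lemma tilted_mat_mono:
  assumes "a \<le> b"
  shows "loewner_le N (tilted_mat N a x) (tilted_mat N b x)"
  using assms norm_square_nonneg[of N v for v]
  by (intro loewner_leI hermitian_tilted_mat) (auto simp: quadratic_form_tilted_mat intro!: mult_right_mono)

text \<open>Scalar parts cancel. For \<open>u = (1, x)\<close> and \<open>w = (1, y)\<close> the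
  commutator of the rank-one parts is \<open><u, w>\<close> times \<open>u w^T - w u^T\<close>: the
  inner product gives \<open>1 + x * y > 0\<close>, the entry \<open>(0, 1)\<close> of the
  difference gives \<open>y - x\<close>.\<close>

lemma tilted_mat_not_commute:
  assumes "2 \<le> N" "x \<noteq> y"
  shows "tilted_mat N a x * tilted_mat N b y - tilted_mat N b y * tilted_mat N a x \<noteq> 0\<^sub>m N N"
proof
  let ?A = "tilted_mat N a x" and ?B = "tilted_mat N b y"
  let ?p = "real (tilt_scale x)" and ?q = "real (tilt_scale y)"
  assume zero: "?A * ?B - ?B * ?A = 0\<^sub>m N N"
  have prod: "(tilted_mat N a x * tilted_mat N b y) $$ (0, 1) = of_real
      ((a / 2 + 1 / real (tilt_scale x)) * (real y / real (tilt_scale y)) +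
       real x / real (tilt_scale x) * (b / 2 + (real y)\<^sup>2 / real (tilt_scale y)))" for a b x y
  proof -
    have "(tilted_mat N a x * tilted_mat N b y) $$ (0, 1) =
        (\<Sum>k<N. tilted_mat N a x $$ (0, k) * tilted_mat N b y $$ (k, 1))"
      using assms by (simp add: times_mat_def scalar_prod_def tilted_mat_def atLeast0LessThan)
    also have "\<dots> = (\<Sum>k<2. tilted_mat N a x $$ (0, k) * tilted_mat N b y $$ (k, 1))"
      by (rule sum.mono_neutral_right) (use assms in \<open>auto simp: tilted_mat_index tilt_def\<close>)
    also have "\<dots> = of_real
      ((a / 2 + 1 / real (tilt_scale x)) * (real y / real (tilt_scale y)) +
       real x / real (tilt_scale x) * (b / 2 + (real y)\<^sup>2 / real (tilt_scale y)))"
      using assms by (simp add: numeral_2_eq_2 tilted_mat_index tilt_def)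
    finally show ?thesis .
  qed
  have "(?A * ?B - ?B * ?A) $$ (0, 1) = (?A * ?B) $$ (0, 1) - (?B * ?A) $$ (0, 1)"
    using assms by (intro index_minus_mat) (simp_all add: tilted_mat_def)
  also have "\<dots> = of_real ((real y - real x) * (1 + real x * real y) / (?p * ?q))"
    unfolding prod of_real_diff[symmetric] of_real_eq_iff
    using tilt_scale_pos[of x] tilt_scale_pos[of y] by (simp add: field_simps power2_eq_square)
  finally have entry: "(?A * ?B - ?B * ?A) $$ (0, 1) =
      of_real ((real y - real x) * (1 + real x * real y) / (?p * ?q))" .
  have "(?A * ?B - ?B * ?A) $$ (0, 1) = 0" using assms zero by simp
  then have "(real y - real x) * (1 + real x * real y) / (?p * ?q) = 0"
    unfolding entry of_real_eq_0_iff .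
  then have "(real y - real x) * (1 + real x * real y) = 0"
    using tilt_scale_pos[of x] tilt_scale_pos[of y] by simp
  moreover have "1 + real x * real y > 0" by (simp add: add_pos_nonneg)
  ultimately show False using assms by simp
qed

section \<open>The universal semi-POVM\<close>

text \<open>Half of the identity is left to the semimeasure, the other half to the tilts: the powers
  of 1/2 sum to 2, divided by 4.\<close>

lemma sum_tilted_weights_le_1:
  assumes "finite F"
  shows "(\<Sum>s\<in>F. universal_semimeasure (string_code s) / 2 + 1 / (4 * 2 ^ string_code s)) \<le> 1"
proof -
  have inj: "inj_on string_code F" using inj_string_code by (rule inj_on_subset) simp
  have "(\<Sum>s\<in>F. universal_semimeasure (string_code s)) \<le> 1"
    using sum_universal_semimeasure_le_1[of "string_code ` F"] assms
    by (simp add: sum.reindex[OF inj] o_def)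
  moreover have "(\<Sum>s\<in>F. (1 / 2) ^ string_code s) \<le> (2::real)"
  proof -
    have "(\<Sum>s\<in>F. (1 / 2) ^ string_code s) = (\<Sum>x\<in>string_code ` F. (1 / 2 :: real) ^ x)"
      by (simp add: sum.reindex[OF inj] o_def)
    also have "\<dots> \<le> (\<Sum>x. (1 / 2) ^ x)"
      using assms by (intro sum_le_suminf summable_geometric) simp_all
    also have "\<dots> = 2" by (subst suminf_geometric) simp_all
    finally show ?thesis .
  qed
  moreover have "(\<Sum>s\<in>F. universal_semimeasure (string_code s) / 2 + 1 / (4 * 2 ^ string_code s)) =
      (\<Sum>s\<in>F. universal_semimeasure (string_code s)) / 2 + (\<Sum>s\<in>F. (1 / 2) ^ string_code s) / 4"
    by (simp add: sum.distrib sum_divide_distrib power_one_over mult.commute)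
  ultimately show ?thesis by linarith
qed

definition universal_povm :: "nat \<Rightarrow> bool list \<Rightarrow> complex mat" where
  "universal_povm N s = tilted_mat N (universal_semimeasure (string_code s)) (string_code s)"

lemma has_sum_sum:
  fixes f :: "'a \<Rightarrow> 'i \<Rightarrow> complex"
  assumes "finite I" "\<And>i. i \<in> I \<Longrightarrow> ((\<lambda>x. f x i) has_sum S i) A"
  shows "((\<lambda>x. \<Sum>i\<in>I. f x i) has_sum (\<Sum>i\<in>I. S i)) A"
  using assms
proof (induction I rule: finite_induct)
  case empty
  show ?case by (simp add: has_sum_0)
next
  case (insert i I)
  then show ?case by (simp add: has_sum_add)
qed

lemma has_sum_quadratic_form:
  assumes "\<And>i j. i < N \<Longrightarrow> j < N \<Longrightarrow> ((\<lambda>s. R s $$ (i, j)) has_sum S $$ (i, j)) UNIV"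
  shows "((\<lambda>s. quadratic_form N (R s) v) has_sum quadratic_form N S v) UNIV"
  unfolding quadratic_form_def
  by (intro has_sum_sum has_sum_cmult_left has_sum_cmult_right assms) auto

lemma semi_POVM_universal_povm:
  assumes "2 \<le> N"
  shows "semi_POVM N (universal_povm N)"
proof -
  let ?m = "\<lambda>s. universal_semimeasure (string_code s)"
  define entry where "entry i j s = (if i = j then ?m s / 2 else 0) +
      real (tilt (string_code s) i) * real (tilt (string_code s) j) / real (tilt_scale (string_code s))"
    for i j :: nat and s
  have index: "universal_povm N s $$ (i, j) = complex_of_real (entry i j s)" if "i < N" "j < N" for i j s
    using that by (simp add: universal_povm_def tilted_mat_index entry_def)
  have entry_nonneg: "entry i j s \<ge> 0" for i j s
    by (simp add: entry_def universal_semimeasure_nonneg)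
  \<comment> \<open>The bound on single entries serves summability only; the bound by the identity
    is obtained from the quadratic forms.\<close>
  have entry_le: "entry i j s \<le> ?m s / 2 + 1 / (4 * 2 ^ string_code s)" for i j s
  proof -
    define x where "x = string_code s"
    have "x \<le> 1 + x ^ 2" by (cases x) (simp_all add: power2_eq_square)
    then have "tilt x i * tilt x j \<le> 1 + x ^ 2"
      by (auto simp: tilt_def less_2_cases_iff power2_eq_square)
    then have "tilt x i * tilt x j * (4 * 2 ^ x) \<le> tilt_scale x"
      unfolding tilt_scale_def by (simp only: mult.commute mult_le_mono1)
    then have "real (tilt x i * tilt x j * (4 * 2 ^ x)) \<le> real (tilt_scale x)"
      by (simp only: of_nat_le_iff)
    then have "real (tilt x i) * real (tilt x j) / real (tilt_scale x) \<le> 1 / (4 * 2 ^ x)"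
      using tilt_scale_pos[of x] by (simp add: field_simps)
    moreover have "(if i = j then ?m s / 2 else 0) \<le> ?m s / 2"
      by (simp add: universal_semimeasure_nonneg)
    ultimately show ?thesis unfolding entry_def x_def by linarith
  qed
  have summable: "entry i j summable_on UNIV" for i j
  proof (rule nonneg_bdd_above_summable_on)
    have "sum (entry i j) F \<le> 1" if "finite F" for F
      using sum_mono[of F, OF entry_le] sum_tilted_weights_le_1[OF that] by (rule order_trans)
    then show "bdd_above (sum (entry i j) ` {F. F \<subseteq> UNIV \<and> finite F})"
      by (intro bdd_aboveI[of _ 1]) auto
  qed (rule entry_nonneg)
  have has_sum: "((\<lambda>s. universal_povm N s $$ (i, j)) has_sum complex_of_real (infsum (entry i j) UNIV)) UNIV"
    if "i < N" "j < N" for i j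
    using has_sum_of_real[OF has_sum_infsum[OF summable[of i j]]] index[OF that] by simp
  define S where "S = mat N N (\<lambda>(i, j). infsum (\<lambda>s. universal_povm N s $$ (i, j)) UNIV)"
  have S_index: "S $$ (i, j) = complex_of_real (infsum (entry i j) UNIV)" if "i < N" "j < N" for i j
    using that infsumI[OF has_sum[OF that]] by (simp add: S_def)
  have "entry i j = entry j i" for i j by (auto simp: entry_def)
  then have S: "hermitian N S"
    unfolding hermitian_def by (auto simp: S_index) (auto simp: S_def)
  have one: "hermitian N (1\<^sub>m N)" by (simp add: hermitian_def)
  have "loewner_le N S (1\<^sub>m N)"
  proof (rule loewner_leI[OF S one])
    fix v
    \<comment> \<open>The form is linear in the matrix, so it passes through the entrywise sums and
      the bound need only be checked on finite sets of strings.\<close>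
    have "((\<lambda>s. quadratic_form N (universal_povm N s) v) has_sum quadratic_form N S v) UNIV"
      by (rule has_sum_quadratic_form) (simp add: has_sum S_index)
    from has_sum_Re[OF this] have "Re (quadratic_form N S v) \<le> norm_square N v"
    proof (rule has_sum_le_finite_sums)
      fix F :: "bool list set" assume "finite F"
      have "(\<Sum>s\<in>F. Re (quadratic_form N (universal_povm N s) v)) \<le>
          (\<Sum>s\<in>F. (?m s / 2 + 1 / (4 * 2 ^ string_code s)) * norm_square N v)"
        unfolding universal_povm_def by (intro sum_mono quadratic_form_tilted_mat_le assms)
      also have "\<dots> \<le> 1 * norm_square N v"
        unfolding sum_distrib_right[symmetric]
        by (intro mult_right_mono sum_tilted_weights_le_1 norm_square_nonneg \<open>finite F\<close>)
      finally show "(\<Sum>s\<in>F. Re (quadratic_form N (universal_povm N s) v)) \<le> norm_square N v" by simp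
    qed
    also have "\<dots> = Re (quadratic_form N (1\<^sub>m N) v)"
    proof -
      have "quadratic_form N (1\<^sub>m N) v = (\<Sum>i<N. \<Sum>j<N. if i = j then v i * cnj (v i) else 0)"
        unfolding quadratic_form_def by (intro sum.cong) auto
      also have "\<dots> = complex_of_real (norm_square N v)"
        by (simp add: norm_square_def of_real_sum complex_norm_square[symmetric])
      finally show ?thesis by simp
    qed
    finally show "Re (quadratic_form N S v) \<le> Re (quadratic_form N (1\<^sub>m N) v)" .
  qed
  moreover have "loewner_le N (0\<^sub>m N N) (universal_povm N s)" for s
  proof (rule loewner_leI)
    show "hermitian N (universal_povm N s)"
      by (simp add: universal_povm_def hermitian_tilted_mat)
    fix v
    have "quadratic_form N (0\<^sub>m N N) v = 0"
      by (simp add: quadratic_form_def)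
    then show "Re (quadratic_form N (0\<^sub>m N N) v) \<le> Re (quadratic_form N (universal_povm N s) v)"
      by (simp add: universal_povm_def quadratic_form_tilted_mat norm_square_nonneg
          universal_semimeasure_nonneg)
  qed (simp add: hermitian_def)
  moreover have "(\<lambda>s. universal_povm N s $$ (i, j)) summable_on UNIV" if "i < N" "j < N" for i j
    using has_sum[OF that] by (auto simp: summable_on_def)
  ultimately show ?thesis by (simp add: semi_POVM_def S_def)
qed

text \<open>The even number \<open>2 * a\<close> is the integer code of \<open>a\<close>; the final
  0 is \<open>pair 0 0\<close>, read as the imaginary part \<open>0 / 0 = 0\<close>.\<close>

lemma complex_of_code_fraction:
  "complex_of_code (pair (pair (2 * a) b) 0) = complex_of_real (real a / real b)"
proof -
  have "prod_decode 0 = (0, 0)"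
    using prod_encode_inverse[of "(0, 0)"] by (simp add: prod_encode_def)
  then show ?thesis
    by (simp add: complex_of_code_def rat_of_code_def int_decode_def sum_decode_def of_rat_divide)
qed

lemma lower_computable_universal_povm:
  assumes "2 \<le> N"
  shows "lower_computable N (universal_povm N)"
proof -
  define approx where
    "approx n s = tilted_mat N (fraction (semimeasure_approx n (string_code s))) (string_code s)" for n s
  \<comment> \<open>With \<open>p / q\<close> the current approximation, the entry is brought to the
    common denominator \<open>2 * q * tilt_scale x\<close>; the outermost factor 2 encodes the
    nonnegative numerator.\<close>
  define code where "code n x i j = pair (pair
      (2 * ((if i = j then pfst (semimeasure_approx n x) * tilt_scale x else 0) +
         2 * psnd (semimeasure_approx n x) * (tilt x i * tilt x j)))
      (2 * psnd (semimeasure_approx n x) * tilt_scale x)) 0" for n x i j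
  define g where "g z = code (pfst z) (pfst (psnd z)) (pfst (psnd (psnd z))) (psnd (psnd (psnd z)))" for z
  have "total_recursive g"
    unfolding g_def code_def tilt_def tilt_scale_def
    by (intro total_recursive_semimeasure_approx total_recursive_intros)
  moreover have "approx n s $$ (i, j) = complex_of_code (g (pair n (pair (string_code s) (pair i j))))"
    if "i < N" "j < N" for n s i j
  proof -
    define x where "x = string_code s"
    define a b where "a = pfst (semimeasure_approx n x)" and "b = psnd (semimeasure_approx n x)"
    have "b > 0" unfolding b_def by (rule psnd_semimeasure_approx_pos)
    have "complex_of_code (g (pair n (pair x (pair i j)))) = complex_of_real
        (real ((if i = j then a * tilt_scale x else 0) + 2 * b * (tilt x i * tilt x j)) /
          real (2 * b * tilt_scale x))"
      by (simp only: g_def code_def pfst_pair psnd_pair complex_of_code_fraction a_def b_def)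
    also have "real ((if i = j then a * tilt_scale x else 0) + 2 * b * (tilt x i * tilt x j)) /
        real (2 * b * tilt_scale x) =
        (if i = j then a / b / 2 else 0) + real (tilt x i) * real (tilt x j) / real (tilt_scale x)"
      using \<open>b > 0\<close> tilt_scale_pos[of x] by (simp add: field_simps)
    finally show ?thesis
      by (simp only: approx_def tilted_mat_index[OF that] fraction_def x_def a_def b_def)
  qed
  moreover have "hermitian N (approx n s)" for n s
    unfolding approx_def by (rule hermitian_tilted_mat)
  moreover have "(\<lambda>n. approx n s $$ (i, j)) \<longlonglongrightarrow> universal_povm N s $$ (i, j)"
    if "i < N" "j < N" for s i j
  proof -
    have "(\<lambda>n. (if i = j then fraction (semimeasure_approx n x) / 2 else 0) +
           real (tilt x i) * real (tilt x j) / real (tilt_scale x))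
      \<longlonglongrightarrow> (if i = j then universal_semimeasure x / 2 else 0) +
           real (tilt x i) * real (tilt x j) / real (tilt_scale x)" for x
      using semimeasure_approx_tendsto[of x] by (cases "i = j") (auto intro!: tendsto_intros)
    then show ?thesis
      unfolding approx_def universal_povm_def tilted_mat_index[OF that] by (rule tendsto_of_real)
  qed
  moreover have "loewner_le N (approx n s) (universal_povm N s)" for n s
    unfolding approx_def universal_povm_def by (rule tilted_mat_mono[OF semimeasure_approx_le])
  ultimately show ?thesis
    unfolding lower_computable_def using semi_POVM_universal_povm[OF assms] by blast
qed

lemma lower_computable_diag_dominated:
  assumes R: "lower_computable N R" and i: "i < N"
  shows "\<exists>c>0. \<forall>s. c * Re (R s $$ (i, i)) \<le> universal_semimeasure (string_code s)"
proof -
  obtain f g where g: "total_recursive g"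
    and f: "\<And>n s i j. i < N \<Longrightarrow> j < N \<Longrightarrow>
        f n s $$ (i, j) = complex_of_code (g (pair n (pair (string_code s) (pair i j))))"
    and lim: "\<And>s i j. i < N \<Longrightarrow> j < N \<Longrightarrow> (\<lambda>n. f n s $$ (i, j)) \<longlonglongrightarrow> R s $$ (i, j)"
    and le: "\<And>n s. loewner_le N (f n s) (R s)"
    using R unfolding lower_computable_def by metis
  have povm: "semi_POVM N R" using R by (simp add: lower_computable_def)
  define h where "h z = g (pair (pfst z) (pair (psnd z) (pair i i)))" for z
  have fh: "f n s $$ (i, i) = complex_of_code (h (pair n (string_code s)))" for n s
    using f[OF i i] by (simp add: h_def)
  have nonneg: "0 \<le> Re (R s $$ (i, i))" for s
    using loewner_le_diag[OF _ i, of "0\<^sub>m N N" "R s"] povm i by (simp add: semi_POVM_def)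
  show ?thesis
  proof (rule universal_semimeasure_dominates_lower_computable)
    show "total_recursive h"
      unfolding h_def by (intro total_recursive_comp[OF g] total_recursive_intros)
    show "0 \<le> Re (R s $$ (i, i))" for s by (rule nonneg)
    show "(\<Sum>s\<in>F. Re (R s $$ (i, i))) \<le> 1" if "finite F" for F
    proof -
      have "(\<lambda>s. R s $$ (i, i)) summable_on UNIV"
        using povm i by (simp add: semi_POVM_def)
      then have "((\<lambda>s. Re (R s $$ (i, i))) has_sum Re (infsum (\<lambda>s. R s $$ (i, i)) UNIV)) UNIV"
        by (intro has_sum_Re has_sum_infsum)
      from finite_sum_le_has_sum[OF this that] nonneg
      have "(\<Sum>s\<in>F. Re (R s $$ (i, i))) \<le> Re (infsum (\<lambda>s. R s $$ (i, i)) UNIV)" by simp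
      also have "\<dots> \<le> 1"
        using loewner_le_diag[OF _ i, of "mat N N (\<lambda>(i, j). infsum (\<lambda>s. R s $$ (i, j)) UNIV)" "1\<^sub>m N"]
          povm i by (simp add: semi_POVM_def)
      finally show ?thesis .
    qed
    show "Re (complex_of_code (h (pair n (string_code s)))) \<le> Re (R s $$ (i, i))" for n s
      unfolding fh[symmetric] by (rule loewner_le_diag[OF le i])
    show "(\<lambda>n. Re (complex_of_code (h (pair n (string_code s))))) \<longlonglongrightarrow> Re (R s $$ (i, i))" for s
      unfolding fh[symmetric] by (rule tendsto_Re[OF lim[OF i i]])
  qed
qed

lemma universal_semi_POVM_universal_povm:
  assumes "2 \<le> N"
  shows "universal_semi_POVM N (universal_povm N)"
  unfolding universal_semi_POVM_def
proof (intro conjI allI impI)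
  show "lower_computable N (universal_povm N)"
    by (rule lower_computable_universal_povm[OF assms])
  fix R assume R: "lower_computable N R"
  obtain C where C: "\<And>i. i < N \<Longrightarrow> C i > 0"
    "\<And>i s. i < N \<Longrightarrow> C i * Re (R s $$ (i, i)) \<le> universal_semimeasure (string_code s)"
    using lower_computable_diag_dominated[OF R] by metis
  have psd: "psd N (R s)" for s
  proof -
    have "R s \<in> carrier_mat N N" "psd N (R s - 0\<^sub>m N N)"
      using R by (auto simp: lower_computable_def semi_POVM_def loewner_le_def)
    moreover from this(1) have "R s - 0\<^sub>m N N = R s" by (intro eq_matI) auto
    ultimately show ?thesis by simp
  qed
  define c where "c = Min (C ` {..<N})"
  have "c > 0" unfolding c_def using assms C(1) by (subst Min_gr_iff) (auto simp: lessThan_empty_iff)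
  have c_le: "c * Re (R s $$ (i, i)) \<le> universal_semimeasure (string_code s)" if "i < N" for i s
  proof -
    have "c * Re (R s $$ (i, i)) \<le> C i * Re (R s $$ (i, i))"
      unfolding c_def by (intro mult_right_mono Min_le psd_diag_nonneg[OF psd that]) (use that in auto)
    with C(2)[OF that, of s] show ?thesis by linarith
  qed
  \<comment> \<open>One factor \<open>N\<close> pays for the trace bound, the other for summing
    \<open>N\<close> diagonal entries, and 2 for the half of the semimeasure placed on the
    diagonal.\<close>
  define d where "d = c / (2 * real N * real N)"
  have "N > 0" using assms by simp
  then have "d > 0" unfolding d_def using \<open>c > 0\<close> by simp
  moreover have "loewner_le N (complex_of_real d \<cdot>\<^sub>m R s) (universal_povm N s)" for s
  proof (rule loewner_leI)
    have herm: "hermitian N (R s)" using psd[of s] by (simp add: psd_iff)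
    then have carrier: "R s \<in> carrier_mat N N" by (rule hermitian_carrier)
    show "hermitian N (complex_of_real d \<cdot>\<^sub>m R s)"
      unfolding hermitian_def
    proof (intro conjI allI impI)
      show "complex_of_real d \<cdot>\<^sub>m R s \<in> carrier_mat N N" using carrier by simp
      fix i j assume ij: "i < N" "j < N"
      have "R s $$ (i, j) = cnj (R s $$ (j, i))" using hermitian_index[OF herm ij] .
      then show "(complex_of_real d \<cdot>\<^sub>m R s) $$ (i, j) = cnj ((complex_of_real d \<cdot>\<^sub>m R s) $$ (j, i))"
        using carrier ij by simp
    qed
    show "hermitian N (universal_povm N s)"
      by (simp add: universal_povm_def hermitian_tilted_mat)
    fix v
    let ?m = "universal_semimeasure (string_code s)"
    have "quadratic_form N (complex_of_real d \<cdot>\<^sub>m R s) v = complex_of_real d * quadratic_form N (R s) v"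
      using carrier by (simp add: quadratic_form_def sum_distrib_left mult_ac)
    then have "Re (quadratic_form N (complex_of_real d \<cdot>\<^sub>m R s) v) = d * Re (quadratic_form N (R s) v)"
      by simp
    also have "\<dots> \<le> d * (real N * (\<Sum>i<N. Re (R s $$ (i, i))) * norm_square N v)"
      using \<open>d > 0\<close> by (intro mult_left_mono psd_quadratic_form_le_trace psd) simp
    also have "\<dots> = (\<Sum>i<N. c * Re (R s $$ (i, i))) / (2 * real N) * norm_square N v"
      using \<open>N > 0\<close> by (simp add: d_def sum_distrib_left[symmetric])
    also have "\<dots> \<le> (\<Sum>i<N. ?m) / (2 * real N) * norm_square N v"
      using c_le by (intro mult_right_mono divide_right_mono sum_mono norm_square_nonneg) auto
    also have "\<dots> = ?m / 2 * norm_square N v"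
      using \<open>N > 0\<close> by simp
    \<comment> \<open>The tilt only adds a nonnegative term to the form.\<close>
    also have "\<dots> \<le> Re (quadratic_form N (universal_povm N s) v)"
      by (simp add: universal_povm_def quadratic_form_tilted_mat)
    finally show "Re (quadratic_form N (complex_of_real d \<cdot>\<^sub>m R s) v) \<le>
        Re (quadratic_form N (universal_povm N s) v)" .
  qed
  ultimately show "\<exists>c>0. \<forall>s. loewner_le N (complex_of_real c \<cdot>\<^sub>m R s) (universal_povm N s)"
    by blast
qed

theorem mainTheorem4:
  fixes N :: nat
  assumes "2 \<le> N"
  shows "\<exists>M. universal_semi_POVM N M \<and>
           (\<forall>s t. s \<noteq> t \<longrightarrow> M s * M t - M t * M s \<noteq> 0\<^sub>m N N)"
proof (intro exI conjI allI impI)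
  show "universal_semi_POVM N (universal_povm N)"
    by (rule universal_semi_POVM_universal_povm[OF assms])
  fix s t :: "bool list" assume "s \<noteq> t"
  then have "string_code s \<noteq> string_code t" using inj_string_code by (simp add: inj_eq)
  then show "universal_povm N s * universal_povm N t - universal_povm N t * universal_povm N s \<noteq> 0\<^sub>m N N"
    unfolding universal_povm_def by (rule tilted_mat_not_commute[OF assms])
qed

end
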